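(* Let $k,\delta\in\mathbb{N}$. There exists $D=D(k,\delta,n)\in\mathbb{N}$ such that for all $d\ge D$, if $S$ is an optimal $(d+k)$-set in the grid $G_{n,d}$ with $|S|=\delta$, then the shadow of $S$ is optimal.
   Context: $\mathbb{N}=\{0,1,2,\dots\}$ and $n\ge3$ is an integer. $G_{n,d}=\{0,1,\dots,d-1\}^n$. The rank of a tuple is the sum of its coordinates; the $r$-th level of $G_{n,d}$ is the set of its elements of rank $r$; an $r$-set is a subset of $G_{n,d}$ all of whose elements have rank $r$. For tuples $u,v$ of the same rank, $v>u$ in the lexicographic order if the first nonzero entry of $v-u$ is positive. The lex segment of size $s$ in level $r$ is the set of the last (i.e. largest) $s$ elements of rank $r$ in the lexicographic order. The shadow of $u\in G_{n,d}$ is the set of all elements of $G_{n,d}$ obtained by adding $1$ to one coordinate of $u$; the shadow of a set is the union of the shadows of its elements. An $r$-set $S\subseteq G_{n,d}$ is optimal if its shadow has the same size as the shadow of the lex segment of size $|S|$ in level $r$. *)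

theory Defs
  imports Main
begin

text \<open>An $n$-tuple $(u_1, \dots, u_n)$ is a list \<open>u\<close> of length \<open>n\<close>, with $u_{i+1}$ being \<open>u ! i\<close>.\<close>

definition grid :: "nat \<Rightarrow> nat \<Rightarrow> nat list set" where
  "grid n d = {u. length u = n \<and> set u \<subseteq> {0..<d}}"

definition rank :: "nat list \<Rightarrow> nat" where
  "rank u = sum_list u"

definition level :: "nat \<Rightarrow> nat \<Rightarrow> nat \<Rightarrow> nat list set" where
  "level n d r = {u \<in> grid n d. rank u = r}"

definition lex_less :: "nat list \<Rightarrow> nat list \<Rightarrow> bool" where
  "lex_less u v \<longleftrightarrow> (u, v) \<in> lex less_than"

lemma lex_less_iff_nth:
  assumes "length u = n" "length v = n"
  shows "lex_less u v \<longleftrightarrow> (\<exists>i<n. u ! i < v ! i \<and> (\<forall>j<i. u ! j = v ! j))"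
proof -
  have "lex_less u v \<longleftrightarrow> (\<exists>i<n. take i u = take i v \<and> u ! i < v ! i)"
    using assms by (auto simp: lex_less_def lexord_lex lexord_take_index_conv)
  also have "\<dots> \<longleftrightarrow> (\<exists>i<n. u ! i < v ! i \<and> (\<forall>j<i. u ! j = v ! j))"
    using assms by (auto simp: list_eq_iff_nth_eq)
  finally show ?thesis .
qed

text \<open>The largest \<open>s\<close> elements of a level are those with fewer than \<open>s\<close> larger elements in that
  level. If \<open>s\<close> exceeds the size of the level, this is the whole level.\<close>

definition lex_segment :: "nat \<Rightarrow> nat \<Rightarrow> nat \<Rightarrow> nat \<Rightarrow> nat list set" where
  "lex_segment n d r s = {u \<in> level n d r. card {v \<in> level n d r. lex_less u v} < s}"

text \<open>The shadow is taken inside the grid: a coordinate equal to \<open>d - 1\<close> cannot be raised.\<close>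

definition elem_shadow :: "nat \<Rightarrow> nat \<Rightarrow> nat list \<Rightarrow> nat list set" where
  "elem_shadow n d u = {v \<in> grid n d. \<exists>i<n. v = u[i := u ! i + 1]}"

definition shadow :: "nat \<Rightarrow> nat \<Rightarrow> nat list set \<Rightarrow> nat list set" where
  "shadow n d S = (\<Union>u\<in>S. elem_shadow n d u)"

definition optimal :: "nat \<Rightarrow> nat \<Rightarrow> nat \<Rightarrow> nat list set \<Rightarrow> bool" where
  "optimal n d r S \<longleftrightarrow>
     S \<subseteq> level n d r \<and> card (shadow n d S) = card (shadow n d (lex_segment n d r (card S)))"

lemma finite_level: "finite (level n d r)"
proof -
  have "level n d r \<subseteq> {u. set u \<subseteq> {0..<d} \<and> length u = n}"
    by (auto simp: level_def grid_def)
  then show ?thesis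
    using finite_lists_length_eq[of "{0..<d}" n] finite_subset by blast
qed

lemma lex_less_trans: "lex_less u v \<Longrightarrow> lex_less v w \<Longrightarrow> lex_less u w"
  unfolding lex_less_def using lex_transI[OF trans_less_than] by (meson transD)

lemma lex_less_irrefl: "\<not> lex_less u u"
  unfolding lex_less_def by (simp add: lexord_lex lexord_irreflexive)

lemma lex_less_total:
  assumes "length u = length v" "u \<noteq> v"
  shows "lex_less u v \<or> lex_less v u"
proof -
  have "(u, v) \<in> lexord less_than \<or> u = v \<or> (v, u) \<in> lexord less_than"
    by (rule lexord_linear) auto
  then show ?thesis
    using assms by (auto simp: lex_less_def lexord_lex)
qed

lemma lex_segment_upward_closed:
  assumes "u \<in> lex_segment n d r s" "v \<in> level n d r" "lex_less u v"
  shows "v \<in> lex_segment n d r s"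
proof -
  have "{w \<in> level n d r. lex_less v w} \<subseteq> {w \<in> level n d r. lex_less u w}"
    using assms(3) lex_less_trans by blast
  then have "card {w \<in> level n d r. lex_less v w} \<le> card {w \<in> level n d r. lex_less u w}"
    by (intro card_mono) (auto simp: finite_level)
  then show ?thesis using assms(1,2) by (auto simp: lex_segment_def)
qed

lemma card_lex_segment:
  assumes "s \<le> card (level n d r)"
  shows "card (lex_segment n d r s) = s"
proof -
  let ?L = "level n d r"
  define f where "f u = card {v \<in> ?L. lex_less u v}" for u
  have less: "f v < f u" if "v \<in> ?L" "lex_less u v" for u v
    unfolding f_def
  proof (rule psubset_card_mono)
    show "{w \<in> ?L. lex_less v w} \<subset> {w \<in> ?L. lex_less u w}"
      using that lex_less_trans lex_less_irrefl[of v] by blast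
  qed (auto intro: finite_subset[OF _ finite_level[of n d r]])
  have inj: "inj_on f ?L"
  proof (rule inj_onI, rule ccontr)
    fix u v assume uv: "u \<in> ?L" "v \<in> ?L" "f u = f v" "u \<noteq> v"
    then have "lex_less u v \<or> lex_less v u"
      by (intro lex_less_total) (auto simp: level_def grid_def)
    then show False using less uv by fastforce
  qed
  have "f u < card ?L" if "u \<in> ?L" for u
    unfolding f_def using that lex_less_irrefl[of u]
    by (intro psubset_card_mono finite_level) blast
  then have "f ` ?L \<subseteq> {..<card ?L}" by auto
  then have image: "f ` ?L = {..<card ?L}"
    using card_image[OF inj] by (intro card_subset_eq) auto
  have "f ` lex_segment n d r s = {..<s}"
  proof (intro equalityI subsetI)
    fix m assume "m \<in> {..<s}"
    then have "m \<in> f ` ?L" using image assms by auto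
    then show "m \<in> f ` lex_segment n d r s"
      using \<open>m \<in> {..<s}\<close> by (auto simp: lex_segment_def f_def)
  qed (auto simp: lex_segment_def f_def)
  moreover have "inj_on f (lex_segment n d r s)"
    using inj by (rule inj_on_subset) (auto simp: lex_segment_def)
  ultimately show ?thesis using card_image by fastforce
qed

end

theory Submission
  imports Defs
begin

text \<open>For large $d$ the statement is about the unbounded grid $\mathbb{N}^n$. There it consists of two
classical theorems on monomial ideals: Macaulay's theorem (lex segments have the smallest shadows)
and Gotzmann's persistence theorem (if the shadow of \<open>S\<close> is as small as possible, then so is the
shadow of this shadow). Both are contained in \<open>persistent\<close>, proved in \<open>persistent_all\<close>.

\<^bold>\<open>Persistence.\<close> Cut a set along the values of one coordinate and replace each section by a lex
segment of $\mathbb{N}^{n-1}$. By induction on $n$ this does not enlarge the shadow. But it does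
not enlarge the second shadow of a set with minimal shadow either, whereas persistence asks for an
upper bound on the second shadow of the original set. Therefore the second shadow is replaced by a
quantity that is at least as large, the number of components of a graph on the pairs \<open>(v, w)\<close>
with \<open>v\<close> in the shadow and \<open>w\<close> covering \<open>v\<close>: two pairs with the same \<open>w\<close> are joined if their first
entries cover a common element of \<open>S\<close>. This graph records the linear syzygies of the monomials in
\<open>S\<close>. If a compression preserves the size of the shadow, the number of its components does not
decrease (\<open>colour_bound_compressed\<close>). Compressing alternately along the first and the last
coordinate ends in a set that is stable: one unit may be moved from the last coordinate to any
other one. The shadow of a stable set splits into the shadow of its section at last coordinate
$0$ and a copy of the set itself, and among stable sets of a given size the lex segment has the
smallest such section (\<open>stable_sec_0_largest\<close>). For stable sets with minimal shadow the components
can then be counted (\<open>stable_colour_bound\<close>), and their number is the size of the second shadow of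
the lex segment.

\<^bold>\<open>Reduction.\<close> Let \<open>S\<close> have $\delta$ elements of rank $d + k$, with $d$ large. Choose a gap
just below $d$, a value that is not the maximal entry of any element. An element with an
entry above the gap lies in the corner of that coordinate, which is unique. Subtract $d$ from the
large entry: the elements of all corners become elements of rank $k$ with one negative coordinate.
Together with the simplex of all nonnegative tuples of rank $k$ they form a set \<open>W\<close>, and the bound
$d$ of the grid disappears, because a tuple whose large entry would reach $d$ enters the simplex
(\<open>up_assemble\<close>). So taking the shadow of the cornered part in the grid is taking the shadow of \<open>W\<close>
in $\mathbb{Z}^n$, up to the size of the simplex. For the lex segment itself the same construction
gives a lex segment of $\mathbb{N}^n$. Elements without a large entry cannot occur: two sets can be
translated so that they are disjoint but their shadows meet (\<open>merge\<close>), so these elements would make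
the shadow larger than necessary. Hence \<open>W\<close> has a minimal shadow, and persistence applies to it.\<close>

section \<open>Shadows and lex segments without an upper bound\<close>

text \<open>The weak compositions of \<open>r\<close> into \<open>n\<close> parts, that is, the levels of $\mathbb{N}^n$.\<close>

definition comps :: "nat \<Rightarrow> nat \<Rightarrow> nat list set" where
  "comps n r = {u. length u = n \<and> sum_list u = r}"

definition covers :: "nat list \<Rightarrow> nat list \<Rightarrow> bool" where
  "covers u v \<longleftrightarrow> (\<exists>i<length u. v = u[i := Suc (u ! i)])"

definition up :: "nat list set \<Rightarrow> nat list set" where
  "up S = {v. \<exists>u\<in>S. covers u v}"

definition segment :: "nat \<Rightarrow> nat \<Rightarrow> nat list set \<Rightarrow> bool" where
  "segment n r A \<longleftrightarrow> A \<subseteq> comps n r \<and> (\<forall>u\<in>A. \<forall>v\<in>comps n r. lex_less u v \<longrightarrow> v \<in> A)"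

lemma comps_eq_level: "comps n r = level n (Suc r) r"
proof -
  have "set u \<subseteq> {0..<Suc (sum_list u)}" for u :: "nat list"
    using member_le_sum_list[of _ u] by (auto simp: less_Suc_eq_le)
  then show ?thesis by (auto simp: comps_def level_def grid_def rank_def)
qed

lemma finite_comps: "finite (comps n r)"
  by (simp add: comps_eq_level finite_level)

lemma not_covers_Nil [simp]: "\<not> covers [] v" by (simp add: covers_def)

lemma covers_Cons:
  "covers (a # u) w \<longleftrightarrow> w = Suc a # u \<or> (\<exists>v. covers u v \<and> w = a # v)"
  unfolding covers_def by (auto simp: less_Suc_eq_0_disj)

lemma covers_length: "covers u v \<Longrightarrow> length v = length u"
  by (auto simp: covers_def)

lemma covers_sum_list: "covers u v \<Longrightarrow> sum_list v = Suc (sum_list u)"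
  by (induction u arbitrary: v) (auto simp: covers_Cons)

lemma covers_snoc:
  "covers (u @ [a]) w \<longleftrightarrow> w = u @ [Suc a] \<or> (\<exists>v. covers u v \<and> w = v @ [a])"
  by (induction u arbitrary: w) (auto simp: covers_Cons)

lemma lex_less_Cons [simp]:
  "lex_less (a # u) (b # v) \<longleftrightarrow> length u = length v \<and> a < b \<or> a = b \<and> lex_less u v"
  by (auto simp: lex_less_def)

lemma lex_less_Nil [simp]: "\<not> lex_less [] v" "\<not> lex_less u []"
  by (auto simp: lex_less_def)

lemma lex_less_length: "lex_less u v \<Longrightarrow> length u = length v"
  by (auto simp: lex_less_def lexord_lex)

lemma lex_less_snoc:
  assumes "length u = length v"
  shows "lex_less (u @ [a]) (v @ [b]) \<longleftrightarrow> lex_less u v \<or> u = v \<and> a < b"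
  using assms by (induction u v rule: list_induct2) auto

lemma covers_lex_less: "covers u v \<Longrightarrow> lex_less u v"
  by (induction u arbitrary: v) (auto simp: covers_Cons)

lemma finite_covers: "finite {v. covers u v}"
proof -
  have "{v. covers u v} = (\<lambda>i. u[i := Suc (u ! i)]) ` {..<length u}"
    by (auto simp: covers_def)
  then show ?thesis by simp
qed

lemma finite_up: "finite S \<Longrightarrow> finite (up S)"
proof -
  have "up S = (\<Union>u\<in>S. {v. covers u v})" by (auto simp: up_def)
  then show "finite S \<Longrightarrow> finite (up S)" using finite_covers by simp
qed

lemma up_mono: "A \<subseteq> B \<Longrightarrow> up A \<subseteq> up B" by (auto simp: up_def)
lemma up_Un: "up (A \<union> B) = up A \<union> up B" by (auto simp: up_def)
lemma up_empty [simp]: "up {} = {}" by (simp add: up_def)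

lemma up_comps: "S \<subseteq> comps n r \<Longrightarrow> up S \<subseteq> comps n (Suc r)"
  by (auto simp: up_def comps_def covers_length covers_sum_list)

lemma ex_covered: "sum_list v > 0 \<Longrightarrow> \<exists>u. covers u v"
proof (induction v)
  case (Cons b v)
  show ?case
  proof (cases b)
    case 0
    then show ?thesis using Cons by (auto simp: covers_Cons intro: exI[of _ "0 # _"])
  next
    case (Suc a)
    then show ?thesis by (intro exI[of _ "a # v"]) (simp add: covers_Cons)
  qed
qed auto

lemma zero_list_eq: "length u = length v \<Longrightarrow> sum_list u = 0 \<Longrightarrow> sum_list v = 0 \<Longrightarrow> u = (v :: nat list)"
  by (induction u v rule: list_induct2) auto

text \<open>This is why the shadow of a lex segment is a lex segment: the largest element covered by \<open>v\<close> arises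
by lowering the last nonzero entry of \<open>v\<close>, and this one is at least \<open>u\<close>. The induction on \<open>u\<close>
builds the witness from the front, without mentioning the last nonzero entry.\<close>

lemma lex_larger_covers:
  assumes "covers u w" "lex_less w v" "sum_list v = sum_list w"
  shows "\<exists>x. covers x v \<and> (x = u \<or> lex_less u x)"
  using assms
proof (induction u arbitrary: w v)
  case (Cons a u)
  obtain b v' where v: "v = b # v'"
    using lex_less_length[OF Cons.prems(2)] Cons.prems(1)
    by (cases v) (auto simp: covers_Cons)
  have len: "length v' = length u"
    using lex_less_length[OF Cons.prems(2)] covers_length[OF Cons.prems(1)] v by simp
  show ?case
  proof (cases "b \<le> Suc a")
    case False
    then have "covers ((b - 1) # v') v" "lex_less (a # u) ((b - 1) # v')"
      using v len by (auto simp: covers_Cons)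
    then show ?thesis by blast
  next
    case True
    from Cons.prems(1) consider "w = Suc a # u" | w' where "covers u w'" "w = a # w'"
      by (auto simp: covers_Cons)
    then show ?thesis
    proof cases
      case 1
      then have "b = Suc a" "lex_less u v'" using Cons.prems(2) v True by auto
      then show ?thesis using v by (intro exI[of _ "a # v'"]) (simp add: covers_Cons)
    next
      case 2
      show ?thesis
      proof (cases "b = a")
        case True
        then obtain x where "covers x v'" "x = u \<or> lex_less u x"
          using Cons.IH[OF 2(1), of v'] Cons.prems 2 v by auto
        then show ?thesis using v True by (intro exI[of _ "a # x"]) (auto simp: covers_Cons)
      next
        case False
        then have b: "b = Suc a" using \<open>b \<le> Suc a\<close> Cons.prems(2) 2 v by auto
        have sum: "sum_list v' = sum_list u"
          using Cons.prems(3) v b 2 covers_sum_list[OF 2(1)] by simp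
        show ?thesis
        proof (cases "sum_list v' = 0")
          case True
          then have "v' = u" using sum len by (intro zero_list_eq) auto
          then show ?thesis using v b by (intro exI[of _ "a # u"]) (simp add: covers_Cons)
        next
          case False
          then obtain y where y: "covers y v'" using ex_covered by blast
          then show ?thesis using v b len covers_length[OF y]
            by (intro exI[of _ "b # y"]) (simp add: covers_Cons)
        qed
      qed
    qed
  qed
qed simp

lemma segment_up:
  assumes "segment n r A" shows "segment n (Suc r) (up A)"
  unfolding segment_def
proof (intro conjI ballI impI)
  show "up A \<subseteq> comps n (Suc r)" using assms up_comps by (simp add: segment_def)
  fix w v assume w: "w \<in> up A" and v: "v \<in> comps n (Suc r)" and less: "lex_less w v"
  then obtain u where u: "u \<in> A" "covers u w" by (auto simp: up_def)
  then have "u \<in> comps n r" using assms by (auto simp: segment_def)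
  then have "sum_list v = sum_list w" using v covers_sum_list[OF u(2)] by (simp add: comps_def)
  then obtain x where x: "covers x v" "x = u \<or> lex_less u x"
    using lex_larger_covers[OF u(2) less] by blast
  have "x \<in> comps n r"
    using v covers_length[OF x(1)] covers_sum_list[OF x(1)] by (simp add: comps_def)
  then have "x \<in> A" using x(2) u(1) assms by (auto simp: segment_def)
  then show "v \<in> up A" using x(1) by (auto simp: up_def)
qed

lemma segment_finite: "segment n r A \<Longrightarrow> finite A"
  using finite_comps finite_subset by (auto simp: segment_def)

lemma segment_chain:
  assumes "segment n r A" "segment n r B" shows "A \<subseteq> B \<or> B \<subseteq> A"
proof (rule ccontr)
  assume "\<not> ?thesis"
  then obtain a b where ab: "a \<in> A" "a \<notin> B" "b \<in> B" "b \<notin> A" by blast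
  then have "length a = length b" "a \<noteq> b" "a \<in> comps n r" "b \<in> comps n r"
    using assms by (auto simp: segment_def comps_def)
  then show False using ab assms lex_less_total[of a b] by (auto simp: segment_def)
qed

text \<open>At rank \<open>r\<close> the bound \<open>Suc r\<close> on the entries is no restriction, so this is the lex segment of
size \<open>s\<close> in \<open>comps n r\<close>.\<close>

definition initial :: "nat \<Rightarrow> nat \<Rightarrow> nat \<Rightarrow> nat list set" where
  "initial n r s = lex_segment n (Suc r) r s"

lemma segment_initial: "segment n r (initial n r s)"
  unfolding segment_def initial_def comps_eq_level
  using lex_segment_upward_closed by (auto simp: lex_segment_def)

lemma card_initial: "S \<subseteq> comps n r \<Longrightarrow> card (initial n r (card S)) = card S"
  unfolding initial_def comps_eq_level
  by (intro card_lex_segment card_mono finite_level)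

section \<open>Counting linear syzygies by colours\<close>

text \<open>The pairs \<open>(v, w)\<close> with \<open>v \<in> up S\<close> and \<open>covers v w\<close> are the vertices of a graph; \<open>(v, w)\<close> and
\<open>(v', w)\<close> are joined if \<open>v\<close> and \<open>v'\<close> cover a common element of \<open>S\<close>. A consistent colouring is
constant on the components, so the number of components is the largest number of colours.
Bounding the colours of all consistent colourings avoids speaking about components.\<close>

definition consistent :: "(nat list \<Rightarrow> nat list \<Rightarrow> 'c) \<Rightarrow> nat list set \<Rightarrow> bool" where
  "consistent f S \<longleftrightarrow> (\<forall>u\<in>S. \<forall>v v' w. covers u v \<and> covers u v' \<and> covers v w \<and> covers v' w
     \<longrightarrow> f v w = f v' w)"

definition colours :: "(nat list \<Rightarrow> nat list \<Rightarrow> 'c) \<Rightarrow> nat list set \<Rightarrow> 'c set" where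
  "colours f S = {f v w | v w. v \<in> up S \<and> covers v w}"

text \<open>One fixed type of colours is needed because the bound is used as an induction hypothesis. Pairs of
a list and a Boolean suffice: the colouring \<open>tagged\<close> below, the only one that has to be exhibited
besides the plain colouring by \<open>w\<close>, uses at most two colours for each \<open>w\<close>.\<close>

definition colour_bound :: "nat list set \<Rightarrow> nat \<Rightarrow> bool" where
  "colour_bound S N \<longleftrightarrow>
     (\<forall>f :: nat list \<Rightarrow> nat list \<Rightarrow> nat list \<times> bool. consistent f S \<longrightarrow> card (colours f S) \<le> N)"

text \<open>Joined pairs have the same second entry, so there are at least as many components as elements of
the second shadow.\<close>

lemma colour_bound_up_up:
  assumes "colour_bound S N" shows "card (up (up S)) \<le> N"
proof -
  let ?f = "\<lambda>v w :: nat list. (w, False)"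
  have "colours ?f S = (\<lambda>w. (w, False)) ` up (up S)"
    by (auto simp: colours_def up_def)
  moreover have "inj_on (\<lambda>w. (w, False)) (up (up S))" by (auto simp: inj_on_def)
  ultimately have "card (colours ?f S) = card (up (up S))" by (simp add: card_image)
  moreover have "consistent ?f S" by (auto simp: consistent_def)
  ultimately show ?thesis using assms unfolding colour_bound_def by metis
qed

lemma finite_colours:
  assumes "finite S" shows "finite (colours f S)"
proof -
  have "colours f S \<subseteq> (\<lambda>(v, w). f v w) ` (up S \<times> up (up S))"
    by (auto simp: colours_def up_def)
  then show ?thesis using assms finite_up by (meson finite_SigmaI finite_imageI finite_subset)
qed

lemma segment_empty [simp]: "segment n r {}" by (simp add: segment_def)

lemma initial_0 [simp]: "initial n r 0 = {}" by (simp add: initial_def lex_segment_def)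

text \<open>Macaulay's theorem together with a strong form of Gotzmann's persistence theorem: for a set with a
minimal shadow, even the components number at most \<open>card (up (up L))\<close>.\<close>

definition persistent :: "nat \<Rightarrow> bool" where
  "persistent n \<longleftrightarrow> (\<forall>r S L. S \<subseteq> comps n r \<and> segment n r L \<and> card L = card S \<longrightarrow>
     card (up L) \<le> card (up S) \<and> (card (up S) = card (up L) \<longrightarrow> colour_bound S (card (up (up L)))))"

lemma persistentD:
  assumes "persistent n" "S \<subseteq> comps n r" "segment n r L" "card L = card S"
  shows "card (up L) \<le> card (up S)"
    and "card (up S) = card (up L) \<Longrightarrow> colour_bound S (card (up (up L)))"
  using assms unfolding persistent_def by blast+

section \<open>Compression along a coordinate\<close>

text \<open>Inserting an entry at the front and inserting an entry at the end are treated alike. These two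
coordinates are the only ones along which sets will be compressed.\<close>

locale coordinate =
  fixes ins :: "nat \<Rightarrow> nat list \<Rightarrow> nat list"
  assumes ins_inject [simp]: "ins i u = ins j v \<longleftrightarrow> i = j \<and> u = v"
    and length_ins [simp]: "length (ins i u) = Suc (length u)"
    and sum_list_ins [simp]: "sum_list (ins i u) = i + sum_list u"
    and ex_ins: "length w = Suc n \<Longrightarrow> \<exists>i v. w = ins i v"
    and covers_ins: "covers (ins i u) w \<longleftrightarrow> w = ins (Suc i) u \<or> (\<exists>v. covers u v \<and> w = ins i v)"
    and lex_less_ins [simp]: "lex_less (ins i u) (ins i v) \<longleftrightarrow> lex_less u v"
begin

lemma covers_ins_flat: "covers u v \<Longrightarrow> covers (ins i u) (ins i v)"
  and covers_ins_steep: "covers (ins i u) (ins (Suc i) u)"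
  by (simp_all add: covers_ins)

definition sec :: "nat list set \<Rightarrow> nat \<Rightarrow> nat list set" where
  "sec S i = {v. ins i v \<in> S}"

text \<open>The section preceding the \<open>i\<close>-th one, which is empty for \<open>i = 0\<close>. Raising the inserted entry maps it
into the \<open>i\<close>-th section of the shadow.\<close>

definition sec_before :: "nat list set \<Rightarrow> nat \<Rightarrow> nat list set" where
  "sec_before S i = {v. \<exists>j. i = Suc j \<and> ins j v \<in> S}"

lemma sec_before_simps [simp]: "sec_before S 0 = {}" "sec_before S (Suc j) = sec S j"
  by (auto simp: sec_before_def sec_def)

lemma sec_up: "sec (up S) i = up (sec S i) \<union> sec_before S i"
proof (rule set_eqI)
  fix v
  have "\<exists>j x. u = ins j x" if "covers u (ins i v)" for u
    using ex_ins[of u "length v"] covers_length[OF that] by simp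
  then have "v \<in> sec (up S) i \<longleftrightarrow> (\<exists>j x. ins j x \<in> S \<and> covers (ins j x) (ins i v))"
    unfolding sec_def up_def by blast
  also have "\<dots> \<longleftrightarrow> v \<in> up (sec S i) \<union> sec_before S i"
    by (auto simp: covers_ins up_def sec_def sec_before_def)
  finally show "v \<in> sec (up S) i \<longleftrightarrow> v \<in> up (sec S i) \<union> sec_before S i" .
qed

lemma sec_comps: "S \<subseteq> comps (Suc n) r \<Longrightarrow> sec S i \<subseteq> comps n (r - i)"
  by (force simp: sec_def comps_def)

lemma sec_beyond: "S \<subseteq> comps (Suc n) r \<Longrightarrow> r < i \<Longrightarrow> sec S i = {}"
  by (force simp: sec_def comps_def)

lemma finite_sec: "S \<subseteq> comps (Suc n) r \<Longrightarrow> finite (sec S i)"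
  using sec_comps finite_comps finite_subset by metis

lemma comps_sections:
  assumes "S \<subseteq> comps (Suc n) r" "r \<le> R"
  shows "S = (\<lambda>(i, v). ins i v) ` (SIGMA i:{..R}. sec S i)"
proof (intro equalityI subsetI)
  fix w assume w: "w \<in> S"
  then have "length w = Suc n" using assms by (auto simp: comps_def)
  then obtain i v where iv: "w = ins i v" using ex_ins by blast
  then have "i \<le> R" using w assms by (force simp: comps_def)
  then show "w \<in> (\<lambda>(i, v). ins i v) ` (SIGMA i:{..R}. sec S i)"
    using w iv by (auto simp: sec_def)
qed (auto simp: sec_def)

lemma sum_sections:
  fixes h :: "nat list \<Rightarrow> nat"
  assumes "S \<subseteq> comps (Suc n) r" "r \<le> R"
  shows "sum h S = (\<Sum>i\<le>R. \<Sum>v\<in>sec S i. h (ins i v))"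
proof -
  have "sum h S = sum h ((\<lambda>(i, v). ins i v) ` (SIGMA i:{..R}. sec S i))"
    using comps_sections[OF assms] by simp
  also have "\<dots> = (\<Sum>(i, v)\<in>(SIGMA i:{..R}. sec S i). h (ins i v))"
    by (subst sum.reindex) (auto simp: inj_on_def case_prod_beta)
  also have "\<dots> = (\<Sum>i\<le>R. \<Sum>v\<in>sec S i. h (ins i v))"
    using finite_sec[OF assms(1)] by (subst sum.Sigma) auto
  finally show ?thesis .
qed

lemma card_sections:
  assumes "S \<subseteq> comps (Suc n) r" "r \<le> R"
  shows "card S = (\<Sum>i\<le>R. card (sec S i))"
  using sum_sections[OF assms, of "\<lambda>_. 1"] by simp

lemma segment_section_parts:
  assumes C: "C \<subseteq> comps (Suc n) r" and seg: "\<And>i. segment n (r - i) (sec C i)"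
  shows "segment n (Suc r - i) (up (sec C i))" "segment n (Suc r - i) (sec_before C i)"
proof -
  show "segment n (Suc r - i) (up (sec C i))"
  proof (cases "i \<le> r")
    case True
    then show ?thesis using segment_up[OF seg[of i]] by (simp add: Suc_diff_le)
  qed (simp add: sec_beyond[OF C])
  show "segment n (Suc r - i) (sec_before C i)"
    using seg by (cases i) auto
qed

text \<open>Throughout, \<open>C\<close> is obtained from \<open>S\<close> by replacing every section by a lex segment of the same size.
A section of the shadow is the union of the shadow of a section and of the preceding section. For
\<open>C\<close> both are lex segments, so one contains the other and the union has the size of the larger one.
For \<open>S\<close> both are at least as large.\<close>

context
  fixes n r S C
  assumes IH: "persistent n"
    and S: "S \<subseteq> comps (Suc n) r" and C: "C \<subseteq> comps (Suc n) r"
    and seg: "\<And>i. segment n (r - i) (sec C i)"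
    and card_sec: "\<And>i. card (sec C i) = card (sec S i)"
begin

lemma card_sec_before: "card (sec_before C i) = card (sec_before S i)"
  using card_sec by (cases i) auto

lemma card_up_sec: "card (up (sec C i)) \<le> card (up (sec S i))"
  using persistentD(1)[OF IH sec_comps[OF S] seg card_sec] .

lemma finite_sec_up: "finite (sec (up S) i)" "finite (sec (up C) i)"
  using finite_sec up_comps S C by metis+

lemma card_sec_up_C: "card (sec (up C) i) = max (card (up (sec C i))) (card (sec_before C i))"
  and sec_up_C_cases: "sec (up C) i = up (sec C i) \<and> sec_before C i \<subseteq> up (sec C i) \<or>
    sec (up C) i = sec_before C i \<and> up (sec C i) \<subseteq> sec_before C i"
proof -
  note parts = segment_section_parts[OF C seg, of i]
  have fin: "finite (up (sec C i))" "finite (sec_before C i)"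
    using parts segment_finite by blast+
  from segment_chain[OF parts] consider "up (sec C i) \<subseteq> sec_before C i"
    | "sec_before C i \<subseteq> up (sec C i)" by blast
  then have "card (sec (up C) i) = max (card (up (sec C i))) (card (sec_before C i)) \<and>
   (sec (up C) i = up (sec C i) \<and> sec_before C i \<subseteq> up (sec C i) \<or>
    sec (up C) i = sec_before C i \<and> up (sec C i) \<subseteq> sec_before C i)"
  proof cases
    case 1
    then show ?thesis using card_mono[OF fin(2) 1] by (auto simp: sec_up Un_absorb1 max_def)
  next
    case 2
    then show ?thesis using card_mono[OF fin(1) 2] by (auto simp: sec_up Un_absorb2 max_def)
  qed
  then show "card (sec (up C) i) = max (card (up (sec C i))) (card (sec_before C i))"
    "sec (up C) i = up (sec C i) \<and> sec_before C i \<subseteq> up (sec C i) \<or>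
    sec (up C) i = sec_before C i \<and> up (sec C i) \<subseteq> sec_before C i" by blast+
qed

lemma card_sec_up_le: "card (sec (up C) i) \<le> card (sec (up S) i)"
proof -
  have "card (up (sec S i)) \<le> card (sec (up S) i)" "card (sec_before S i) \<le> card (sec (up S) i)"
    using finite_sec_up by (auto intro!: card_mono simp: sec_up)
  then show ?thesis using card_up_sec[of i] card_sec_before[of i] card_sec_up_C[of i] by simp
qed

lemma card_up_compressed: "card (up C) \<le> card (up S)"
  using card_sections[OF up_comps[OF S] order_refl] card_sections[OF up_comps[OF C] order_refl]
    card_sec_up_le by (simp add: sum_mono del: sum.atMost_Suc)

text \<open>A consistent colouring of \<open>C\<close> with as many colours as possible. The pair \<open>(ins i x, ins (Suc i) x)\<close>
is isolated unless \<open>x\<close> lies in the shadow of the \<open>i\<close>-th section; the tag marks the isolated pairs.\<close>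

definition tagged :: "nat list \<Rightarrow> nat list \<Rightarrow> nat list \<times> bool" where
  "tagged v w = (w, \<exists>i x. v = ins i x \<and> w = ins (Suc i) x \<and> x \<notin> up (sec C i))"

lemma consistent_tagged: "consistent tagged C"
proof -
  have *: "snd (tagged v' w)"
    if u: "u \<in> C" "covers u v" "covers u v'" "covers v w" "covers v' w" and t: "snd (tagged v w)"
    for u v v' w
  proof -
    obtain i x where ix: "v = ins i x" "w = ins (Suc i) x" "x \<notin> up (sec C i)"
      using t by (auto simp: tagged_def)
    have "length u = Suc n" using u(1) C by (auto simp: comps_def)
    then obtain j y where jy: "u = ins j y" using ex_ins by blast
    have "\<not> (i = j \<and> covers y x)" using ix jy u(1) by (auto simp: up_def sec_def)
    then have ij: "i = Suc j" "x = y" using u(2) ix jy by (auto simp: covers_ins)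
    have "v' = v" using u(3,5) ix jy ij by (auto simp: covers_ins)
    then show ?thesis using t by simp
  qed
  show ?thesis unfolding consistent_def
  proof (intro ballI allI impI)
    fix u v v' w assume "u \<in> C" "covers u v \<and> covers u v' \<and> covers v w \<and> covers v' w"
    then have "snd (tagged v w) \<longleftrightarrow> snd (tagged v' w)" using * by blast
    then show "tagged v w = tagged v' w" by (simp add: tagged_def)
  qed
qed

lemma colours_tagged:
  "(\<Sum>i\<le>Suc R. card (up (sec (up C) i))) + (\<Sum>i\<le>R. card (sec (up C) i - up (sec C i)))
     \<le> card (colours tagged C)"
proof -
  let ?A = "(\<lambda>(i, x). (ins i x, False)) ` (SIGMA i:{..Suc R}. up (sec (up C) i))"
  let ?B = "(\<lambda>(i, x). (ins (Suc i) x, True)) ` (SIGMA i:{..R}. sec (up C) i - up (sec C i))"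
  have fin: "finite (up (sec (up C) i))" for i using finite_sec_up finite_up by blast
  have "card ?A = card (SIGMA i:{..Suc R}. up (sec (up C) i))"
    by (intro card_image) (auto simp: inj_on_def)
  also have "\<dots> = (\<Sum>i\<le>Suc R. card (up (sec (up C) i)))"
    using fin by (intro card_SigmaI) auto
  finally have A: "card ?A = (\<Sum>i\<le>Suc R. card (up (sec (up C) i)))" .
  have "card ?B = card (SIGMA i:{..R}. sec (up C) i - up (sec C i))"
    by (intro card_image) (auto simp: inj_on_def)
  also have "\<dots> = (\<Sum>i\<le>R. card (sec (up C) i - up (sec C i)))"
    using finite_sec_up by (intro card_SigmaI) auto
  finally have B: "card ?B = (\<Sum>i\<le>R. card (sec (up C) i - up (sec C i)))" .
  have "(ins i x, False) \<in> colours tagged C" if "x \<in> up (sec (up C) i)" for i x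
  proof -
    from that obtain y where y: "ins i y \<in> up C" "covers y x" unfolding sec_def up_def[of "Collect _"] by blast
    then have "tagged (ins i y) (ins i x) = (ins i x, False)" "covers (ins i y) (ins i x)"
      by (auto simp: tagged_def covers_ins)
    then show ?thesis using y unfolding colours_def sec_def by force
  qed
  then have "?A \<subseteq> colours tagged C" by auto
  moreover have "(ins (Suc i) x, True) \<in> colours tagged C"
    if x: "x \<in> sec (up C) i" "x \<notin> up (sec C i)" for i x
  proof -
    have "tagged (ins i x) (ins (Suc i) x) = (ins (Suc i) x, True)"
      "covers (ins i x) (ins (Suc i) x)"
      using x by (auto simp: tagged_def covers_ins)
    then show ?thesis using x unfolding colours_def sec_def by force
  qed
  then have "?B \<subseteq> colours tagged C" by auto
  ultimately have "card (?A \<union> ?B) \<le> card (colours tagged C)"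
    using finite_colours finite_subset[OF C finite_comps] by (intro card_mono) auto
  moreover have "card (?A \<union> ?B) = card ?A + card ?B"
    using fin finite_sec_up by (intro card_Un_disjoint finite_imageI finite_SigmaI) auto
  ultimately show ?thesis using A B by simp
qed

text \<open>Fix a consistent colouring of \<open>S\<close> and consider the pairs \<open>(v, w)\<close> with \<open>w\<close> in the \<open>i\<close>-th section.
Such a pair is flat if \<open>v\<close> lies in the same section as \<open>w\<close>, and steep if it lies in the preceding
one. Equality of the shadow sizes means that the sections of the shadows of \<open>S\<close> and \<open>C\<close> have the
same sizes. Hence the larger one of the two parts of a section of the shadow of \<open>S\<close> fills it.
If this is the shadow of the \<open>i\<close>-th section, that section has a minimal shadow, and the induction
hypothesis bounds the colours of the flat pairs; the steep pairs above the shadow of the preceding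
section repeat colours of flat pairs. If it is the preceding section, every flat pair has the
colour of a steep pair. In both cases the count is at most that of \<open>tagged\<close> on \<open>C\<close>.\<close>

lemma colour_bound_compressed:
  assumes eq: "card (up C) = card (up S)" and N: "colour_bound C N"
  shows "colour_bound S N"
  unfolding colour_bound_def
proof (intro allI impI)
  fix f :: "nat list \<Rightarrow> nat list \<Rightarrow> nat list \<times> bool"
  assume f: "consistent f S"
  define Col where "Col i = {f v (ins i y) | v y. v \<in> up S \<and> covers v (ins i y)}" for i
  define flat where "flat i = {f (ins i x) (ins i y) | x y. x \<in> sec (up S) i \<and> covers x y}" for i
  define steep where "steep i x = f (ins i x) (ins (Suc i) x)" for i x
  have card_eq: "card (sec (up C) i) = card (sec (up S) i)" for i
  proof (cases "i \<le> Suc r")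
    case True
    have "(\<Sum>i\<le>Suc r. card (sec (up C) i)) = (\<Sum>i\<le>Suc r. card (sec (up S) i))"
      using eq card_sections[OF up_comps[OF S] order_refl] card_sections[OF up_comps[OF C] order_refl]
      by (simp del: sum.atMost_Suc)
    then show ?thesis by (rule sum_mono_inv) (use card_sec_up_le True in auto)
  qed (use sec_beyond[OF up_comps[OF S]] sec_beyond[OF up_comps[OF C]] in simp)
  have finS: "finite S" using S finite_comps finite_subset by blast
  have fin_up: "finite (up (sec S i))" for i using finite_sec[OF S] finite_up by blast
  \<comment> \<open>Both \<open>ins (Suc i) x\<close> and \<open>ins i y\<close> cover the element \<open>ins i x\<close> of \<open>S\<close>.\<close>
  have glue: "f (ins (Suc i) x) (ins (Suc i) y) = steep i y" if "x \<in> sec S i" "covers x y" for i x y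
    using f that unfolding consistent_def steep_def sec_def
    by (elim ballE[where x = "ins i x"]) (auto simp: covers_ins)
  have up_surj: "\<exists>j x. v = ins j x" if "v \<in> up S" for v
    using that up_comps[OF S] ex_ins[of v n] by (auto simp: comps_def)
  have Col_0: "Col 0 = flat 0"
  proof (intro equalityI subsetI)
    fix c assume "c \<in> Col 0"
    then obtain v y where vy: "v \<in> up S" "covers v (ins 0 y)" "c = f v (ins 0 y)"
      by (auto simp: Col_def)
    obtain j x where "v = ins j x" using up_surj[OF vy(1)] by blast
    then show "c \<in> flat 0" using vy by (auto simp: covers_ins flat_def sec_def)
  next
    fix c assume "c \<in> flat 0"
    then show "c \<in> Col 0"
      unfolding Col_def flat_def sec_def using covers_ins_flat by blast
  qed
  have Col_Suc: "Col (Suc i) = flat (Suc i) \<union> steep i ` sec (up S) i" for i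
  proof (intro equalityI subsetI)
    fix c assume "c \<in> Col (Suc i)"
    then obtain v y where vy: "v \<in> up S" "covers v (ins (Suc i) y)" "c = f v (ins (Suc i) y)"
      by (auto simp: Col_def)
    obtain j x where "v = ins j x" using up_surj[OF vy(1)] by blast
    then show "c \<in> flat (Suc i) \<union> steep i ` sec (up S) i"
      using vy by (auto simp: covers_ins flat_def steep_def sec_def)
  next
    fix c assume "c \<in> flat (Suc i) \<union> steep i ` sec (up S) i"
    then show "c \<in> Col (Suc i)"
      unfolding Col_def flat_def steep_def sec_def
      using covers_ins_flat covers_ins_steep by blast
  qed
  have flat_fin: "finite (flat i)" for i
  proof (rule finite_subset)
    show "flat i \<subseteq> colours f S" unfolding flat_def colours_def sec_def using covers_ins_flat by blast
  qed (simp add: finite_colours finS)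
  have flat_le: "card (flat i) \<le> card (up (sec (up C) i))"
    if dom: "sec (up C) i = up (sec C i)" for i
  proof -
    have "card (up (sec S i)) \<le> card (sec (up S) i)"
      using finite_sec_up by (auto intro!: card_mono simp: sec_up)
    then have cards: "card (up (sec S i)) = card (up (sec C i))"
      using card_up_sec[of i] card_eq[of i] dom by simp
    have sub: "up (sec S i) = sec (up S) i"
      using card_eq[of i] dom cards finite_sec_up by (intro card_subset_eq) (auto simp: sec_up)
    have "flat i = colours (\<lambda>x y. f (ins i x) (ins i y)) (sec S i)"
      by (auto simp: flat_def colours_def sub)
    moreover have "consistent (\<lambda>x y. f (ins i x) (ins i y)) (sec S i)"
      unfolding consistent_def
    proof (intro ballI allI impI)
      fix u v v' w
      assume "u \<in> sec S i" "covers u v \<and> covers u v' \<and> covers v w \<and> covers v' w"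
      then have "ins i u \<in> S" "covers (ins i u) (ins i v)" "covers (ins i u) (ins i v')"
        "covers (ins i v) (ins i w)" "covers (ins i v') (ins i w)"
        by (auto simp: sec_def covers_ins)
      then show "f (ins i v) (ins i w) = f (ins i v') (ins i w)"
        using f unfolding consistent_def by blast
    qed
    ultimately show ?thesis
      using persistentD(2)[OF IH sec_comps[OF S] seg card_sec cards] dom
      unfolding colour_bound_def by metis
  qed
  have le_0: "card (Col 0) \<le> card (up (sec (up C) 0))"
    using flat_le[of 0] by (simp add: Col_0 sec_up)
  have le_Suc: "card (Col (Suc i)) \<le>
      card (up (sec (up C) (Suc i))) + card (sec (up C) i - up (sec C i))" for i
  proof -
    have sub: "up (sec C i) \<subseteq> sec (up C) i" "up (sec S i) \<subseteq> sec (up S) i"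
      by (auto simp: sec_up)
    have diff: "card (sec (up C) i - up (sec C i)) = card (sec (up C) i) - card (up (sec C i))"
      using sub finite_sec_up by (intro card_Diff_subset finite_subset[OF sub(1)]) auto
    from sec_up_C_cases[of "Suc i"] show ?thesis
    proof (elim disjE conjE)
      assume dom: "sec (up C) (Suc i) = up (sec C (Suc i))"
      have "Col (Suc i) \<subseteq> flat (Suc i) \<union> steep i ` (sec (up S) i - up (sec S i))"
      proof -
        have "steep i y \<in> flat (Suc i)" if "y \<in> up (sec S i)" for y
        proof -
          obtain x where x: "x \<in> sec S i" "covers x y" using \<open>y \<in> up (sec S i)\<close> by (auto simp: up_def)
          then have "x \<in> sec (up S) (Suc i)" by (simp add: sec_up)
          then show ?thesis using x glue[OF x] unfolding flat_def by force
        qed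
        then show ?thesis by (auto simp: Col_Suc)
      qed
      then have "card (Col (Suc i)) \<le> card (flat (Suc i) \<union> steep i ` (sec (up S) i - up (sec S i)))"
        using flat_fin finite_sec_up by (intro card_mono) auto
      also have "\<dots> \<le> card (flat (Suc i)) + card (sec (up S) i - up (sec S i))"
        using finite_sec_up by (intro order_trans[OF card_Un_le] add_mono card_image_le) auto
      also have "card (sec (up S) i - up (sec S i)) = card (sec (up C) i) - card (up (sec S i))"
        using sub finite_sec_up card_eq by (subst card_Diff_subset) (auto intro: fin_up)
      also have "\<dots> \<le> card (sec (up C) i - up (sec C i))"
        using diff card_up_sec[of i] by simp
      finally show ?thesis using flat_le[OF dom] by simp
    next
      assume "sec (up C) (Suc i) = sec_before C (Suc i)"
      then have dom: "sec (up C) (Suc i) = sec C i" by simp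
      have "sec S i = sec (up S) (Suc i)"
        using dom card_eq[of "Suc i"] card_sec finite_sec_up finite_sec[OF S]
        by (intro card_subset_eq) (auto simp: sec_up)
      then have "flat (Suc i) \<subseteq> steep i ` up (sec S i)"
        using glue by (auto simp: flat_def up_def)
      then have "Col (Suc i) = steep i ` sec (up S) i" 
        using sub unfolding Col_Suc by blast
      then have "card (Col (Suc i)) \<le> card (sec (up C) i)"
        using card_image_le finite_sec_up card_eq by metis
      also have "\<dots> = card (up (sec C i)) + card (sec (up C) i - up (sec C i))"
        using diff card_mono[OF finite_sec_up(2) sub(1)] by simp
      finally show ?thesis using dom by simp
    qed
  qed
  have "colours f S \<subseteq> (\<Union>i\<le>Suc (Suc r). Col i)"
  proof
    fix c assume "c \<in> colours f S"
    then obtain v w where vw: "v \<in> up S" "covers v w" "c = f v w" by (auto simp: colours_def)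
    then have "w \<in> comps (Suc n) (Suc (Suc r))"
      using up_comps[OF up_comps[OF S]] by (auto simp: up_def)
    then obtain i y where "w = ins i y" "i \<le> Suc (Suc r)"
      using ex_ins[of w n] by (auto simp: comps_def)
    then show "c \<in> (\<Union>i\<le>Suc (Suc r). Col i)" using vw unfolding Col_def by blast
  qed
  moreover have "finite (Col i)" for i
    using flat_fin finite_sec_up by (cases i) (simp_all add: Col_0 Col_Suc)
  ultimately have "card (colours f S) \<le> card (\<Union>i\<le>Suc (Suc r). Col i)"
    by (intro card_mono) auto
  also have "\<dots> \<le> (\<Sum>i\<le>Suc (Suc r). card (Col i))" by (rule card_UN_le) simp
  also have "\<dots> = card (Col 0) + (\<Sum>i\<le>Suc r. card (Col (Suc i)))"
    by (rule sum.atMost_Suc_shift)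
  also have "\<dots> \<le> card (up (sec (up C) 0)) + (\<Sum>i\<le>Suc r.
      card (up (sec (up C) (Suc i))) + card (sec (up C) i - up (sec C i)))"
    by (intro add_mono sum_mono le_0 le_Suc)
  also have "\<dots> = (\<Sum>i\<le>Suc (Suc r). card (up (sec (up C) i))) +
      (\<Sum>i\<le>Suc r. card (sec (up C) i - up (sec C i)))"
    by (simp add: sum.atMost_Suc_shift[of _ "Suc r"] sum.distrib del: sum.atMost_Suc)
  also have "\<dots> \<le> card (colours tagged C)" by (rule colours_tagged)
  also have "\<dots> \<le> N" using N consistent_tagged unfolding colour_bound_def by blast
  finally show "card (colours f S) \<le> N" .
qed

end

end

section \<open>Sets compressed along the first and the last coordinate\<close>

text \<open>The position in the decreasing lex order. Compression replaces elements by lex larger ones, so it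
lowers the total weight, and repeated compression ends.\<close>

definition weight :: "nat \<Rightarrow> nat \<Rightarrow> nat list \<Rightarrow> nat" where
  "weight n r u = card {v \<in> comps n r. lex_less u v}"

lemma weight_strict:
  assumes "v \<in> comps n r" "lex_less u v" shows "weight n r v < weight n r u"
  unfolding weight_def
proof (rule psubset_card_mono)
  show "finite {w \<in> comps n r. lex_less u w}" using finite_comps by simp
  show "{w \<in> comps n r. lex_less v w} \<subset> {w \<in> comps n r. lex_less u w}"
    using assms lex_less_trans lex_less_irrefl[of v] by blast
qed

lemma segment_sum_less:
  fixes h :: "nat list \<Rightarrow> nat"
  assumes A: "segment n r A" and B: "B \<subseteq> comps n r" and card: "card A = card B" and "A \<noteq> B"
    and h: "\<And>u v. u \<in> comps n r \<Longrightarrow> v \<in> comps n r \<Longrightarrow> lex_less u v \<Longrightarrow> h v < h u"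
  shows "sum h A < sum h B"
proof -
  have fin: "finite A" "finite B" using A B segment_finite finite_comps finite_subset by blast+
  have "card (A - B) = card (B - A)"
    using card fin by (simp add: card_Diff_subset_Int Int_commute)
  then obtain g where g: "bij_betw g (A - B) (B - A)"
    using fin finite_same_card_bij[of "A - B" "B - A"] by blast
  have "A - B \<noteq> {}"
    using card_seteq[OF fin(2), of A] card \<open>A \<noteq> B\<close> by auto
  have less: "h a < h b" if "a \<in> A - B" "b \<in> B - A" for a b
  proof -
    have ab: "a \<in> comps n r" "b \<in> comps n r" "a \<noteq> b"
      using that A B by (auto simp: segment_def)
    then have "lex_less a b \<or> lex_less b a"
      by (intro lex_less_total) (auto simp: comps_def)
    moreover have "\<not> lex_less a b" using that A ab by (auto simp: segment_def)
    ultimately show ?thesis using h ab by blast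
  qed
  have "sum h (A - B) < (\<Sum>a\<in>A - B. h (g a))"
    using fin \<open>A - B \<noteq> {}\<close> less bij_betwE[OF g] by (intro sum_strict_mono) auto
  also have "\<dots> = sum h (B - A)" by (rule sum.reindex_bij_betw[OF g])
  finally have "sum h (A \<inter> B) + sum h (A - B) < sum h (B \<inter> A) + sum h (B - A)"
    by (simp add: Int_commute)
  then show ?thesis using fin by (simp add: sum.Int_Diff[symmetric])
qed

context coordinate
begin

definition compress :: "nat \<Rightarrow> nat \<Rightarrow> nat list set \<Rightarrow> nat list set" where
  "compress n r S = {ins i v | i v. v \<in> initial n (r - i) (card (sec S i))}"

lemma sec_compress: "sec (compress n r S) i = initial n (r - i) (card (sec S i))"
  by (auto simp: compress_def sec_def)

lemma compress_comps:
  assumes "S \<subseteq> comps (Suc n) r" shows "compress n r S \<subseteq> comps (Suc n) r"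
proof
  fix w assume "w \<in> compress n r S"
  then obtain i v where w: "w = ins i v" and v: "v \<in> initial n (r - i) (card (sec S i))"
    by (auto simp: compress_def)
  then have "i \<le> r" using sec_beyond[OF assms, of i] by (cases "i \<le> r") auto
  moreover have "v \<in> comps n (r - i)" using v segment_initial by (auto simp: segment_def)
  ultimately show "w \<in> comps (Suc n) r" using w by (simp add: comps_def)
qed

lemma compress_improves:
  assumes IH: "persistent n" and S: "S \<subseteq> comps (Suc n) r"
    and "\<not> (\<forall>i. segment n (r - i) (sec S i))"
  shows "\<exists>C \<subseteq> comps (Suc n) r. card C = card S \<and> card (up C) \<le> card (up S) \<and>
    (card (up C) = card (up S) \<longrightarrow> (\<forall>N. colour_bound C N \<longrightarrow> colour_bound S N)) \<and>
    sum (weight (Suc n) r) C < sum (weight (Suc n) r) S"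
proof -
  define C where "C = compress n r S"
  have C: "C \<subseteq> comps (Suc n) r" unfolding C_def by (rule compress_comps[OF S])
  have seg: "segment n (r - i) (sec C i)" for i
    unfolding C_def sec_compress by (rule segment_initial)
  have cards: "card (sec C i) = card (sec S i)" for i
    unfolding C_def sec_compress by (rule card_initial[OF sec_comps[OF S]])
  have "card C = card S"
    unfolding card_sections[OF C order_refl] card_sections[OF S order_refl] cards ..
  obtain i where i: "\<not> segment n (r - i) (sec S i)" using assms by blast
  then have "i \<le> r" using sec_beyond[OF S, of i] by (cases "i \<le> r") auto
  have strict: "(\<Sum>v\<in>sec C j. weight (Suc n) r (ins j v)) < (\<Sum>v\<in>sec S j. weight (Suc n) r (ins j v))"
    if "sec C j \<noteq> sec S j" "j \<le> r" for j
    using seg sec_comps[OF S] cards that(1)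
  proof (rule segment_sum_less)
    fix u v assume "v \<in> comps n (r - j)" "lex_less u v"
    then show "weight (Suc n) r (ins j v) < weight (Suc n) r (ins j u)"
      using that(2) by (intro weight_strict) (auto simp: comps_def)
  qed
  have "sum (weight (Suc n) r) C < sum (weight (Suc n) r) S"
    unfolding sum_sections[OF C order_refl] sum_sections[OF S order_refl]
  proof (rule sum_strict_mono_ex1)
    show "\<forall>j\<in>{..r}. (\<Sum>v\<in>sec C j. weight (Suc n) r (ins j v)) \<le> (\<Sum>v\<in>sec S j. weight (Suc n) r (ins j v))"
      using strict by (metis atMost_iff le_eq_less_or_eq)
    show "\<exists>j\<in>{..r}. (\<Sum>v\<in>sec C j. weight (Suc n) r (ins j v)) < (\<Sum>v\<in>sec S j. weight (Suc n) r (ins j v))"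
      using strict[of i] i seg[of i] \<open>i \<le> r\<close> by (metis atMost_iff)
  qed simp
  then show ?thesis
    using C \<open>card C = card S\<close> card_up_compressed[OF IH S C seg cards]
      colour_bound_compressed[OF IH S C seg cards] by blast
qed

end

interpretation first: coordinate Cons
proof
  show "\<exists>i v. w = i # v" if "length w = Suc n" for w :: "nat list" and n
    using that by (cases w) auto
qed (auto simp: covers_Cons)

interpretation final: coordinate "\<lambda>i v. v @ [i]"
proof
  show "\<exists>i v. w = v @ [i]" if "length w = Suc n" for w :: "nat list" and n
    using that by (cases w rule: rev_cases) auto
  show "lex_less (u @ [i]) (v @ [i]) \<longleftrightarrow> lex_less u v" for i u v
    using lex_less_snoc[of u v i i] lex_less_length[of u v] lex_less_length[of "u @ [i]" "v @ [i]"]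
    by auto
qed (auto simp: covers_snoc)

definition compressed :: "nat \<Rightarrow> nat \<Rightarrow> nat list set \<Rightarrow> bool" where
  "compressed n r U \<longleftrightarrow>
     (\<forall>i. segment n (r - i) (first.sec U i)) \<and> (\<forall>i. segment n (r - i) (final.sec U i))"

lemma ex_compressed:
  assumes "persistent n" "S \<subseteq> comps (Suc n) r"
  shows "\<exists>U \<subseteq> comps (Suc n) r. compressed n r U \<and> card U = card S \<and> card (up U) \<le> card (up S) \<and>
    (card (up U) = card (up S) \<longrightarrow> (\<forall>N. colour_bound U N \<longrightarrow> colour_bound S N))"
  using assms(2)
proof (induction "sum (weight (Suc n) r) S" arbitrary: S rule: less_induct)
  case less
  show ?case
  proof (cases "compressed n r S")
    case False
    then obtain C where C: "C \<subseteq> comps (Suc n) r" "card C = card S" "card (up C) \<le> card (up S)"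
      "card (up C) = card (up S) \<longrightarrow> (\<forall>N. colour_bound C N \<longrightarrow> colour_bound S N)"
      "sum (weight (Suc n) r) C < sum (weight (Suc n) r) S"
      using first.compress_improves[OF assms(1) less.prems] final.compress_improves[OF assms(1) less.prems]
      unfolding compressed_def by blast
    from less.hyps[OF C(5,1)] obtain U where U: "U \<subseteq> comps (Suc n) r" "compressed n r U"
      "card U = card C" "card (up U) \<le> card (up C)"
      "card (up U) = card (up C) \<longrightarrow> (\<forall>N. colour_bound U N \<longrightarrow> colour_bound C N)" by blast
    show ?thesis using C(2-4) U by (intro exI[of _ U]) auto
  qed (use less.prems in blast)
qed

text \<open>A unit of the last coordinate may be moved to any other coordinate, and the section at \<open>0\<close> is a lex
segment. Lex segments and sets compressed along two coordinates have these properties, which are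
what the following proofs use of the stability of Borel fixed ideals.\<close>

definition stable :: "nat \<Rightarrow> nat \<Rightarrow> nat list set \<Rightarrow> bool" where
  "stable n r U \<longleftrightarrow> U \<subseteq> comps (Suc n) r \<and> segment n r (final.sec U 0) \<and>
     (\<forall>i. up (final.sec U (Suc i)) \<subseteq> final.sec U i)"

lemma lex_least_cover:
  assumes "covers (x @ [b]) v" shows "v = x @ [Suc b] \<or> lex_less (x @ [Suc b]) v"
  using assms by (auto simp: covers_snoc lex_less_snoc covers_length covers_lex_less)

lemma segment_stable:
  assumes L: "segment (Suc n) r L" shows "stable n r L"
  unfolding stable_def
proof (intro conjI allI subsetI)
  fix i v assume "v \<in> up (final.sec L (Suc i))"
  then obtain u where u: "u @ [Suc i] \<in> L" "covers u v" by (auto simp: up_def final.sec_def)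
  then have "lex_less (u @ [Suc i]) (v @ [i])"
    by (simp add: lex_less_snoc covers_length covers_lex_less)
  moreover have "v @ [i] \<in> comps (Suc n) r"
    using u L covers_length[OF u(2)] covers_sum_list[OF u(2)] by (auto simp: segment_def comps_def)
  ultimately show "v \<in> final.sec L i" using u L by (auto simp: segment_def final.sec_def)
next
  show "segment n r (final.sec L 0)"
    using L by (force simp: segment_def final.sec_def comps_def)
qed (use L in \<open>auto simp: segment_def\<close>)

text \<open>The least favourable move of a unit is from the last to the second to last coordinate. It does not
change the first coordinate, so it stays inside a section along the first coordinate and is a step
upwards in the lex order there. This needs a coordinate in front of the last two, whence \<open>2 \<le> n\<close>.
All other moves are larger in the lex order of the section along the last coordinate.\<close>

lemma compressed_stable:
  assumes U: "U \<subseteq> comps (Suc n) r" and c: "compressed n r U" and n: "2 \<le> n"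
  shows "stable n r U"
  unfolding stable_def
proof (intro conjI allI subsetI)
  show "segment n r (final.sec U 0)" using c unfolding compressed_def by (metis diff_zero)
  fix i v assume "v \<in> up (final.sec U (Suc i))"
  then obtain u where u: "u @ [Suc i] \<in> U" "covers u v" by (auto simp: up_def final.sec_def)
  have len: "length u = n" and sum: "sum_list u + Suc i = r" using u U by (auto simp: comps_def)
  obtain a u' where "u = a # u'" using len n by (cases u) auto
  moreover obtain x b where "u' = x @ [b]" using len n calculation by (cases u' rule: rev_cases) auto
  ultimately have ux: "u = a # x @ [b]" by simp
  have "x @ [b, Suc i] \<in> first.sec U a" using u ux by (simp add: first.sec_def)
  moreover have "lex_less (x @ [b, Suc i]) (x @ [Suc b, i])"
    using lex_less_snoc[of "x @ [b]" "x @ [Suc b]" "Suc i" i] by (simp add: lex_less_snoc)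
  moreover have "x @ [Suc b, i] \<in> comps n (r - a)" using len sum ux by (auto simp: comps_def)
  ultimately have "x @ [Suc b, i] \<in> first.sec U a" using c by (auto simp: compressed_def segment_def)
  then have least: "a # x @ [Suc b] \<in> final.sec U i" by (simp add: first.sec_def final.sec_def)
  have "v \<in> comps n (r - i)"
    using covers_length[OF u(2)] covers_sum_list[OF u(2)] len sum by (auto simp: comps_def)
  moreover have "v = a # x @ [Suc b] \<or> lex_less (a # x @ [Suc b]) v"
    using lex_least_cover[of "a # x" b v] u ux by simp
  ultimately show "v \<in> final.sec U i" using least c by (auto simp: compressed_def segment_def)
qed (use U in auto)

lemma stable_sec_up:
  assumes "stable n r U"
  shows "final.sec (up U) 0 = up (final.sec U 0)" "final.sec (up U) (Suc i) = final.sec U i"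
  using assms by (auto simp: stable_def final.sec_up)

text \<open>By stability each section of the shadow beyond the one at \<open>0\<close> is just the preceding section of the
set. So minimising the shadow means minimising the shadow of the section at \<open>0\<close>.\<close>

lemma stable_card_up:
  assumes "stable n r U" shows "card (up U) = card (up (final.sec U 0)) + card U"
proof -
  have U: "U \<subseteq> comps (Suc n) r" using assms by (simp add: stable_def)
  have "card (up U) = (\<Sum>i\<le>Suc r. card (final.sec (up U) i))"
    by (rule final.card_sections[OF up_comps[OF U] order_refl])
  also have "\<dots> = card (final.sec (up U) 0) + (\<Sum>i\<le>r. card (final.sec (up U) (Suc i)))"
    by (rule sum.atMost_Suc_shift)
  also have "\<dots> = card (up (final.sec U 0)) + card U"
    using final.card_sections[OF U order_refl] by (simp add: stable_sec_up[OF assms])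
  finally show ?thesis .
qed

lemma stable_push:
  assumes "stable n r U" "x @ [b, i] \<in> U" shows "x @ [b + i, 0] \<in> U"
  using assms(2)
proof (induction i arbitrary: b)
  case (Suc i)
  have "x @ [b] \<in> final.sec U (Suc i)" using Suc.prems by (simp add: final.sec_def)
  moreover have "covers (x @ [b]) (x @ [Suc b])" by (simp add: covers_snoc)
  ultimately have "x @ [Suc b] \<in> final.sec U i"
    using assms(1) unfolding stable_def up_def by blast
  then show ?case using Suc.IH[of "Suc b"] by (simp add: final.sec_def)
qed simp

text \<open>Suppose that \<open>l @ [0]\<close> is in \<open>L\<close> but not in \<open>U\<close>. Moving the whole last entry of any \<open>w \<in> U\<close> to its
neighbour gives an element of the section at \<open>0\<close>, which is a lex segment not containing \<open>l\<close>; so that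
element exceeds \<open>l\<close>. As the ranks agree, the first difference is not in the last entry, hence it is
already present between \<open>w\<close> and \<open>l @ [0]\<close>. So all of \<open>U\<close> lies in \<open>L\<close>, and by size \<open>U = L\<close>.\<close>

lemma stable_sec_0_largest:
  assumes U: "stable n r U" and L: "segment (Suc n) r L" and card: "card L = card U" and n: "1 \<le> n"
  shows "final.sec L 0 \<subseteq> final.sec U 0"
proof (rule ccontr)
  assume "\<not> ?thesis"
  then obtain l where l: "l @ [0] \<in> L" "l @ [0] \<notin> U" by (auto simp: final.sec_def)
  have Lc: "L \<subseteq> comps (Suc n) r" and Uc: "U \<subseteq> comps (Suc n) r"
    using L U by (auto simp: segment_def stable_def)
  have lc: "l \<in> comps n r" using l Lc by (auto simp: comps_def)
  then obtain y c where y: "l = y @ [c]" using n by (cases l rule: rev_cases) (auto simp: comps_def)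
  have "U \<subseteq> L"
  proof
    fix w assume w: "w \<in> U"
    then have wc: "length w = Suc n" "sum_list w = r" using Uc by (auto simp: comps_def)
    obtain w' i where w': "w = w' @ [i]" using wc by (cases w rule: rev_cases) auto
    obtain x b where x: "w = x @ [b, i]" using w' wc n by (cases w' rule: rev_cases) auto
    have "x @ [b + i] \<in> final.sec U 0"
      using stable_push[OF U] w x by (simp add: final.sec_def)
    moreover have "l \<notin> final.sec U 0" using l by (simp add: final.sec_def)
    ultimately have "\<not> lex_less (x @ [b + i]) l" "x @ [b + i] \<noteq> l"
      using U lc unfolding stable_def segment_def by blast+
    moreover have len: "length x = length y" "sum_list x + b + i = sum_list y + c"
      using wc x lc y by (auto simp: comps_def)
    ultimately have "lex_less (y @ [c]) (x @ [b + i])"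
      using lex_less_total[of "x @ [b + i]" l] y by auto
    then have "lex_less y x"
      using len by (auto simp: lex_less_snoc)
    then have "lex_less (l @ [0]) w"
      using x y len lex_less_snoc[of "y @ [c]" "x @ [b]" 0 i] by (simp add: lex_less_snoc)
    then show "w \<in> L" using L l w Uc by (auto simp: segment_def)
  qed
  then have "U = L" using card_seteq[OF segment_finite[OF L]] card by simp
  then show False using l by simp
qed

text \<open>Outside the section at \<open>0\<close>, stability identifies every pair with a pair that raises the last
entry, so each element of the shadow contributes at most one colour there. The pairs inside the
section at \<open>0\<close> are bounded by the induction hypothesis, applied to a lex segment.\<close>

lemma stable_colour_bound:
  assumes IH: "persistent n" and U: "stable n r U"
  shows "colour_bound U (card (up (up (final.sec U 0))) + card (up U))"
  unfolding colour_bound_def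
proof (intro allI impI)
  fix f :: "nat list \<Rightarrow> nat list \<Rightarrow> nat list \<times> bool"
  assume f: "consistent f U"
  let ?g = "\<lambda>x y. f (x @ [0]) (y @ [0])"
  let ?h = "\<lambda>v. f v (butlast v @ [Suc (last v)])"
  have Uc: "U \<subseteq> comps (Suc n) r" using U by (simp add: stable_def)
  have "consistent ?g (final.sec U 0)"
    unfolding consistent_def
  proof (intro ballI allI impI)
    fix u v v' w
    assume "u \<in> final.sec U 0" "covers u v \<and> covers u v' \<and> covers v w \<and> covers v' w"
    then have "u @ [0] \<in> U" "covers (u @ [0]) (v @ [0])" "covers (u @ [0]) (v' @ [0])"
      "covers (v @ [0]) (w @ [0])" "covers (v' @ [0]) (w @ [0])"
      by (auto simp: final.sec_def covers_snoc)
    then show "?g v w = ?g v' w" using f unfolding consistent_def by blast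
  qed
  moreover have seg: "segment n r (final.sec U 0)" using U by (simp add: stable_def)
  then have "colour_bound (final.sec U 0) (card (up (up (final.sec U 0))))"
    by (intro persistentD(2)[OF IH]) (auto simp: segment_def)
  ultimately have bound: "card (colours ?g (final.sec U 0)) \<le> card (up (up (final.sec U 0)))"
    unfolding colour_bound_def by blast
  have "colours f U \<subseteq> colours ?g (final.sec U 0) \<union> ?h ` up U"
  proof
    fix c assume "c \<in> colours f U"
    then obtain v w where vw: "v \<in> up U" "covers v w" "c = f v w" by (auto simp: colours_def)
    have "length v = Suc n" using vw(1) up_comps[OF Uc] by (auto simp: comps_def)
    then obtain x i where x: "v = x @ [i]" using final.ex_ins by blast
    show "c \<in> colours ?g (final.sec U 0) \<union> ?h ` up U"
    proof (cases "w = x @ [Suc i]")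
      case True
      then have "c = ?h v" using vw x by simp
      then show ?thesis using vw(1) by blast
    next
      case False
      then obtain y where y: "w = y @ [i]" "covers x y" using vw x by (auto simp: covers_snoc)
      have xs: "x \<in> final.sec (up U) i" using vw x by (simp add: final.sec_def)
      show ?thesis
      proof (cases i)
        case 0
        then have "x \<in> up (final.sec U 0)" using xs stable_sec_up(1)[OF U] by simp
        then show ?thesis using vw x y 0 unfolding colours_def by blast
      next
        case (Suc j)
        then have "x \<in> final.sec U j" using xs stable_sec_up(2)[OF U] by simp
        then have xU: "x @ [j] \<in> U" by (simp add: final.sec_def)
        have cov: "covers (x @ [j]) (x @ [i])" "covers (x @ [j]) (y @ [j])"
          "covers (x @ [i]) (y @ [i])" "covers (y @ [j]) (y @ [i])"
          using y Suc by (auto simp: covers_snoc)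
        then have "c = f (y @ [j]) (y @ [i])"
          using f xU vw x y unfolding consistent_def by blast
        then have "c = ?h (y @ [j])" using Suc by simp
        moreover have "y @ [j] \<in> up U" using xU cov unfolding up_def by blast
        ultimately show ?thesis by blast
      qed
    qed
  qed
  moreover have "finite U" using Uc finite_comps finite_subset by blast
  then have "finite (up U)" by (rule finite_up)
  moreover have "finite (colours ?g (final.sec U 0))"
    by (intro finite_colours segment_finite[OF seg])
  ultimately have "card (colours f U) \<le> card (colours ?g (final.sec U 0) \<union> ?h ` up U)"
    by (intro card_mono) auto
  also have "\<dots> \<le> card (colours ?g (final.sec U 0)) + card (?h ` up U)" by (rule card_Un_le)
  also have "\<dots> \<le> card (up (up (final.sec U 0))) + card (up U)"
    using bound \<open>finite (up U)\<close> by (intro add_mono card_image_le)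
  finally show "card (colours f U) \<le> card (up (up (final.sec U 0))) + card (up U)" .
qed

text \<open>Compress \<open>S\<close> to a stable set \<open>U\<close>. If the shadows of \<open>U\<close> and \<open>L\<close> have the same size, their sections
at \<open>0\<close>, one contained in the other, have the same shadow; so the bound on the colours of \<open>U\<close> is the
size of the second shadow of \<open>L\<close>.\<close>

lemma persistent_Suc:
  assumes IH: "persistent n" and n: "2 \<le> n" shows "persistent (Suc n)"
  unfolding persistent_def
proof (intro allI impI, elim conjE)
  fix r S L
  assume S: "S \<subseteq> comps (Suc n) r" and L: "segment (Suc n) r L" and card: "card L = card S"
  obtain U where U: "U \<subseteq> comps (Suc n) r" "compressed n r U" "card U = card S"
    "card (up U) \<le> card (up S)"
    "card (up U) = card (up S) \<longrightarrow> (\<forall>N. colour_bound U N \<longrightarrow> colour_bound S N)"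
    using ex_compressed[OF IH S] by blast
  have stU: "stable n r U" using compressed_stable U n by blast
  have stL: "stable n r L" by (rule segment_stable[OF L])
  have sub: "final.sec L 0 \<subseteq> final.sec U 0"
    using stable_sec_0_largest[OF stU L] U card n by simp
  have fin: "finite (up (final.sec U 0))"
    using final.finite_sec[OF U(1)] by (rule finite_up)
  have le: "card (up (final.sec L 0)) \<le> card (up (final.sec U 0))"
    by (rule card_mono[OF fin up_mono[OF sub]])
  then have le_U: "card (up L) \<le> card (up U)"
    using stable_card_up[OF stU] stable_card_up[OF stL] U card by simp
  show "card (up L) \<le> card (up S) \<and>
    (card (up S) = card (up L) \<longrightarrow> colour_bound S (card (up (up L))))"
  proof (intro conjI impI)
    show "card (up L) \<le> card (up S)" using le_U U by simp
    assume eq: "card (up S) = card (up L)"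
    then have eqU: "card (up U) = card (up L)" using le_U U by simp
    then have "card (up (final.sec L 0)) = card (up (final.sec U 0))"
      using stable_card_up[OF stU] stable_card_up[OF stL] U card by simp
    then have same: "up (final.sec L 0) = up (final.sec U 0)"
      using card_subset_eq[OF fin up_mono[OF sub]] by simp
    have "stable n (Suc r) (up L)" using segment_stable segment_up[OF L] by blast
    then have "card (up (up L)) = card (up (up (final.sec U 0))) + card (up U)"
      using stable_card_up stable_sec_up(1)[OF stL] same eqU by simp
    then have "colour_bound U (card (up (up L)))" using stable_colour_bound[OF IH stU] by simp
    then show "colour_bound S (card (up (up L)))" using U eq eqU by simp
  qed
qed

section \<open>Persistence in the unbounded grid\<close>

text \<open>The induction starts with $n = 2$, where a level is a path. A nonempty set has at least one more
element in its shadow than it has itself, with equality for segments.\<close>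

lemma covers_pair: "covers [a, b] w \<longleftrightarrow> w = [Suc a, b] \<or> w = [a, Suc b]"
  by (auto simp: covers_Cons)

lemma comps_2_cases:
  assumes "u \<in> comps 2 r" obtains a b where "u = [a, b]"
  using assms by (auto simp: comps_def numeral_2_eq_2 length_Suc_conv)

definition inc_hd :: "nat list \<Rightarrow> nat list" where "inc_hd u = Suc (hd u) # tl u"

lemma inc_hd_Cons [simp]: "inc_hd (a # u) = Suc a # u" by (simp add: inc_hd_def)

lemma card_inc_hd_2:
  assumes "S \<subseteq> comps 2 r"
  shows "inc_hd ` S \<subseteq> up S" "card (inc_hd ` S) = card S"
proof -
  show "inc_hd ` S \<subseteq> up S"
    using assms by (force simp: up_def covers_pair elim: comps_2_cases)
  have "inj_on inc_hd S"
  proof (rule inj_onI)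
    fix u v assume "u \<in> S" "v \<in> S" "inc_hd u = inc_hd v"
    then show "u = v" using assms by (metis comps_2_cases inc_hd_Cons list.inject nat.inject subsetD)
  qed
  then show "card (inc_hd ` S) = card S" by (rule card_image)
qed

lemma card_up_2_ge:
  assumes S: "S \<subseteq> comps 2 r" and "S \<noteq> {}" shows "Suc (card S) \<le> card (up S)"
proof -
  have fin: "finite (up S)" using S finite_comps finite_subset finite_up by metis
  have "inc_hd ` S \<noteq> up S"
  proof
    assume eq: "inc_hd ` S = up S"
    have "[a, b] \<notin> S" for a b
    proof (induction a arbitrary: b)
      case (0 b)
      have "[0, Suc b] \<in> up S" if "[0, b] \<in> S" using that by (force simp: up_def covers_pair)
      moreover have "[0, Suc b] \<notin> inc_hd ` S" by (auto simp: inc_hd_def)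
      ultimately show ?case using eq by blast
    next
      case (Suc a b)
      show ?case
      proof
        assume "[Suc a, b] \<in> S"
        then have "[Suc a, Suc b] \<in> inc_hd ` S" using eq by (force simp: up_def covers_pair)
        then obtain u where "u \<in> S" "[Suc a, Suc b] = inc_hd u" by blast
        moreover obtain c d where "u = [c, d]" using S calculation(1) comps_2_cases by blast
        ultimately have "[a, Suc b] \<in> S" by simp
        then show False using Suc.IH by blast
      qed
    qed
    then show False using \<open>S \<noteq> {}\<close> S comps_2_cases by (metis equals0I subsetD)
  qed
  then have "inc_hd ` S \<subset> up S" using card_inc_hd_2[OF S] by blast
  then show ?thesis using psubset_card_mono[OF fin, of "inc_hd ` S"] card_inc_hd_2[OF S] by simp
qed

lemma card_up_2_segment:
  assumes L: "segment 2 r L" and "L \<noteq> {}" shows "card (up L) = Suc (card L)"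
proof (rule antisym)
  have Lc: "L \<subseteq> comps 2 r" using L by (simp add: segment_def)
  have fin: "finite (up L)" using L segment_finite finite_up by blast
  have new: "\<exists>a b. v = [a, Suc b] \<and> [a, b] \<in> L \<and> (a = 0 \<or> [a - 1, Suc b] \<notin> L)"
    if v: "v \<in> up L - inc_hd ` L" for v
  proof -
    obtain u where u: "u \<in> L" "covers u v" using v by (auto simp: up_def)
    obtain a b where ab: "u = [a, b]" using u Lc comps_2_cases by blast
    have "v \<noteq> [Suc a, b]" using v imageI[OF u(1), of inc_hd] ab by auto
    then have vab: "v = [a, Suc b]" using u ab by (auto simp: covers_pair)
    have "a = 0 \<or> [a - 1, Suc b] \<notin> L"
      using v vab imageI[of "[a - 1, Suc b]" L inc_hd] by (cases a) auto
    with u(1) ab vab show ?thesis by simp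
  qed
  have "v = v'" if vv: "v \<in> up L - inc_hd ` L" "v' \<in> up L - inc_hd ` L" for v v'
  proof -
    obtain a b where ab: "v = [a, Suc b]" "[a, b] \<in> L" "a = 0 \<or> [a - 1, Suc b] \<notin> L"
      using new[OF vv(1)] by blast
    obtain a' b' where ab': "v' = [a', Suc b']" "[a', b'] \<in> L" "a' = 0 \<or> [a' - 1, Suc b'] \<notin> L"
      using new[OF vv(2)] by blast
    have sum: "a + b = r" "a' + b' = r" using ab(2) ab'(2) Lc by (auto simp: comps_def)
    have *: "\<not> c < c'" if "[c, d] \<in> L" "c' = 0 \<or> [c' - 1, Suc d'] \<notin> L" "c' + d' = r" for c d c' d'
    proof
      assume less: "c < c'"
      then have "[c' - 1, Suc d'] \<in> comps 2 r" using that by (simp add: comps_def)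
      moreover have "[c, d] = [c' - 1, Suc d'] \<or> lex_less [c, d] [c' - 1, Suc d']"
        using less that(1,3) Lc by (auto simp: comps_def)
      ultimately have "[c' - 1, Suc d'] \<in> L"
        using L that(1) unfolding segment_def by metis
      then show False using that less by simp
    qed
    show ?thesis using *[OF ab(2) ab'(3) sum(2)] *[OF ab'(2) ab(3) sum(1)] sum ab ab' by simp
  qed
  then have "card (up L - inc_hd ` L) \<le> 1"
    using fin by (simp add: card_le_Suc0_iff_eq)
  moreover have "card (up L - inc_hd ` L) = card (up L) - card L"
    using card_inc_hd_2[OF Lc] fin by (metis card_Diff_subset finite_subset)
  ultimately show "card (up L) \<le> Suc (card L)" by simp
  show "Suc (card L) \<le> card (up L)" by (rule card_up_2_ge[OF Lc \<open>L \<noteq> {}\<close>])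
qed

text \<open>A pair that raises the second entry of \<open>v\<close> has the colour of a pair raising a first entry, if \<open>v\<close>
arises from an element of \<open>S\<close> by raising the first entry. This leaves \<open>card (up S) - card S\<close> further
pairs, which is a single one if \<open>S\<close> is not empty and has a minimal shadow.\<close>

lemma colour_bound_2:
  assumes S: "S \<subseteq> comps 2 r"
  shows "colour_bound S (card (up S) + (card (up S) - card S))"
  unfolding colour_bound_def
proof (intro allI impI)
  fix f :: "nat list \<Rightarrow> nat list \<Rightarrow> nat list \<times> bool"
  assume f: "consistent f S"
  let ?p = "\<lambda>v. f v (inc_hd v)" and ?q = "\<lambda>v. f v [hd v, Suc (hd (tl v))]"
  have fin: "finite (up S)" using S finite_comps finite_subset finite_up by metis
  have "colours f S \<subseteq> ?p ` up S \<union> ?q ` (up S - inc_hd ` S)"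
  proof
    fix c assume "c \<in> colours f S"
    then obtain v w where vw: "v \<in> up S" "covers v w" "c = f v w" by (auto simp: colours_def)
    obtain a b where ab: "v = [a, b]" using vw(1) up_comps[OF S] comps_2_cases
      by (metis Suc_1 subsetD comps_2_cases)
    consider "w = inc_hd v" | "w = [a, Suc b]" "v \<notin> inc_hd ` S" | "w = [a, Suc b]" "v \<in> inc_hd ` S"
      using vw ab by (auto simp: covers_pair)
    then show "c \<in> ?p ` up S \<union> ?q ` (up S - inc_hd ` S)"
    proof cases
      case 1
      then show ?thesis using vw by blast
    next
      case 2
      then have "c = ?q v" using vw ab by simp
      then show ?thesis using vw 2 by blast
    next
      case 3
      then obtain u where u: "u \<in> S" "v = inc_hd u" by blast
      then obtain a' where a': "u = [a', b]" "a = Suc a'"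
        using ab S comps_2_cases by (metis inc_hd_Cons list.inject subsetD)
      have cov: "covers u v" "covers u [a', Suc b]" "covers v w" "covers [a', Suc b] w"
        using a' ab 3 by (auto simp: covers_pair)
      then have "f v w = f [a', Suc b] w" using f u(1) unfolding consistent_def by blast
      then have "c = ?p [a', Suc b]" using vw 3 a' by simp
      moreover have "[a', Suc b] \<in> up S" using u(1) cov(2) by (auto simp: up_def)
      ultimately show ?thesis by blast
    qed
  qed
  then have "card (colours f S) \<le> card (?p ` up S \<union> ?q ` (up S - inc_hd ` S))"
    using fin by (intro card_mono) auto
  also have "\<dots> \<le> card (?p ` up S) + card (?q ` (up S - inc_hd ` S))" by (rule card_Un_le)
  also have "\<dots> \<le> card (up S) + card (up S - inc_hd ` S)"
    using fin by (intro add_mono card_image_le) auto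
  also have "card (up S - inc_hd ` S) = card (up S) - card S"
    using card_inc_hd_2[OF S] fin by (metis card_Diff_subset finite_subset)
  finally show "card (colours f S) \<le> card (up S) + (card (up S) - card S)" .
qed

lemma persistent_2: "persistent 2"
  unfolding persistent_def
proof (intro allI impI, elim conjE)
  fix r S L
  assume S: "S \<subseteq> comps 2 r" and L: "segment 2 r L" and card: "card L = card S"
  have fin: "finite S" "finite L" using S L segment_finite finite_comps finite_subset by blast+
  show "card (up L) \<le> card (up S) \<and>
    (card (up S) = card (up L) \<longrightarrow> colour_bound S (card (up (up L))))"
  proof (cases "S = {}")
    case True
    then have "L = {}" using card fin by simp
    then show ?thesis using True by (simp add: colour_bound_def colours_def)
  next
    case False
    then have "L \<noteq> {}" using card fin by auto
    note up_L = card_up_2_segment[OF L this]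
    then have "up L \<noteq> {}" by auto
    then have up_up_L: "card (up (up L)) = Suc (card (up L))"
      using card_up_2_segment segment_up[OF L] by blast
    show ?thesis
      using card_up_2_ge[OF S False] up_L up_up_L card colour_bound_2[OF S] by auto
  qed
qed

theorem persistent_all: "2 \<le> n \<Longrightarrow> persistent n"
proof (induction n rule: dec_induct)
  case base
  show ?case by (rule persistent_2)
qed (simp add: persistent_Suc)

section \<open>Translating and merging sets\<close>

definition padd :: "nat list \<Rightarrow> nat list \<Rightarrow> nat list" where
  "padd u v = map2 (+) u v"

lemma padd_simps [simp]: "padd [] v = []" "padd u [] = []" "padd (a # u) (b # v) = (a + b) # padd u v"
  by (simp_all add: padd_def)

lemma length_padd [simp]: "length (padd u v) = min (length u) (length v)"
  by (simp add: padd_def)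

lemma nth_padd: "i < length u \<Longrightarrow> i < length v \<Longrightarrow> padd u v ! i = u ! i + v ! i"
  by (simp add: padd_def)

lemma padd_commute: "padd u v = padd v u"
  by (induction u v rule: list_induct2') auto

lemma sum_list_padd: "length u = length v \<Longrightarrow> sum_list (padd u v) = sum_list u + sum_list v"
  by (induction u v rule: list_induct2) auto

lemma padd_inject:
  assumes "length u = length w" "length v = length w"
  shows "padd u w = padd v w \<longleftrightarrow> u = v"
  using assms
proof (induction u w arbitrary: v rule: list_induct2)
  case (Cons x xs y ys)
  then show ?case by (cases v) auto
qed simp

lemma lex_less_padd:
  assumes "length u = length w" "length v = length w"
  shows "lex_less (padd u w) (padd v w) \<longleftrightarrow> lex_less u v"
  using assms
proof (induction u w arbitrary: v rule: list_induct2)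
  case (Cons x xs y ys)
  then show ?case by (cases v) auto
qed simp

lemma covers_padd:
  assumes "length u = length w"
  shows "covers (padd u w) x \<longleftrightarrow> (\<exists>v. covers u v \<and> x = padd v w)"
  using assms
proof (induction u w arbitrary: x rule: list_induct2)
  case (Cons a u b w)
  show ?case by (auto simp: covers_Cons Cons.IH)
qed simp

definition translate :: "nat list \<Rightarrow> nat list set \<Rightarrow> nat list set" where
  "translate p A = (\<lambda>u. padd u p) ` A"

lemma translate_comps:
  "A \<subseteq> comps n r \<Longrightarrow> length p = n \<Longrightarrow> translate p A \<subseteq> comps n (r + sum_list p)"
  by (force simp: translate_def comps_def sum_list_padd)

lemma card_translate:
  assumes "A \<subseteq> comps n r" "length p = n" shows "card (translate p A) = card A"
proof -
  have "length u = length p" if "u \<in> A" for u using assms that by (auto simp: comps_def)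
  then show ?thesis unfolding translate_def
    by (intro card_image inj_onI) (simp add: padd_inject)
qed

lemma up_translate:
  assumes "A \<subseteq> comps n r" "length p = n" shows "up (translate p A) = translate p (up A)"
proof -
  have "length u = length p" if "u \<in> A" for u using assms that by (auto simp: comps_def)
  then show ?thesis by (force simp: up_def translate_def covers_padd)
qed

text \<open>Translation preserves the sizes of sets and of shadows. So the smallest shadow of a set of given
size is equally large at all ranks where such sets exist, and sets of different ranks can be
compared.\<close>

lemma segment_translate_hd:
  assumes L: "segment (Suc m) r L"
  shows "segment (Suc m) (r + t) (translate (t # replicate m 0) L)"
  unfolding segment_def
proof (intro conjI ballI impI)
  let ?p = "t # replicate m 0"
  have Lc: "L \<subseteq> comps (Suc m) r" using L by (simp add: segment_def)
  show "translate ?p L \<subseteq> comps (Suc m) (r + t)"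
    using translate_comps[OF Lc, of ?p] by (simp add: sum_list_replicate)
  fix w v assume w: "w \<in> translate ?p L" and v: "v \<in> comps (Suc m) (r + t)" and less: "lex_less w v"
  obtain u where u: "u \<in> L" "w = padd u ?p" using w by (auto simp: translate_def)
  have zero: "padd x (replicate m 0) = x" if "length x = m" for x
    using that by (induction x arbitrary: m) auto
  obtain b v' where v': "v = b # v'" "length v' = m"
    using v by (cases v) (auto simp: comps_def)
  obtain a u' where u': "u = a # u'" "length u' = m" using u Lc by (cases u) (auto simp: comps_def)
  have "t \<le> b" using less u u' v' by auto
  then have eq: "v = padd ((b - t) # v') ?p" using v' zero by simp
  then have "lex_less u ((b - t) # v')" using less u u' v' lex_less_padd[of u ?p "(b - t) # v'"] by simp
  moreover have "(b - t) # v' \<in> comps (Suc m) r" using v v' \<open>t \<le> b\<close> by (auto simp: comps_def)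
  ultimately have "(b - t) # v' \<in> L" using L u by (auto simp: segment_def)
  then show "v \<in> translate ?p L" unfolding translate_def using eq by blast
qed

lemma lex_greatest:
  assumes "A \<subseteq> comps n r" "A \<noteq> {}"
  obtains a where "a \<in> A" "\<And>u. u \<in> A \<Longrightarrow> u = a \<or> lex_less u a"
proof -
  obtain a0 where "a0 \<in> A" using assms by blast
  then obtain a where a: "a \<in> A" "\<And>u. u \<in> A \<Longrightarrow> weight n r a \<le> weight n r u"
    using ex_has_least_nat[of "\<lambda>u. u \<in> A" a0 "weight n r"] by blast
  have "u = a \<or> lex_less u a" if "u \<in> A" for u
  proof (rule ccontr)
    assume "\<not> ?thesis"
    then have "lex_less a u" using lex_less_total[of u a] assms a that by (auto simp: comps_def)
    then show False using weight_strict[of u n r a] a(2)[OF that] assms that by auto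
  qed
  then show thesis using that a by blast
qed

lemma lex_smallest:
  assumes "A \<subseteq> comps n r" "A \<noteq> {}"
  obtains a where "a \<in> A" "\<And>u. u \<in> A \<Longrightarrow> u = a \<or> lex_less a u"
proof -
  obtain a0 where a0: "a0 \<in> A" using assms by blast
  have "\<forall>u. u \<in> A \<longrightarrow> weight n r u < Suc (card (comps n r))"
    using finite_comps by (auto simp: weight_def less_Suc_eq_le intro: card_mono)
  then obtain a where a: "a \<in> A" "\<And>u. u \<in> A \<Longrightarrow> weight n r u \<le> weight n r a"
    using ex_has_greatest_nat[of "\<lambda>u. u \<in> A" a0 "weight n r"] a0 by blast
  have "u = a \<or> lex_less a u" if "u \<in> A" for u
  proof (rule ccontr)
    assume "\<not> ?thesis"
    then have "lex_less u a" using lex_less_total[of u a] assms a that by (auto simp: comps_def)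
    then show False using weight_strict[of a n r u] a(2)[OF that] assms a(1) by auto
  qed
  then show thesis using that a by blast
qed

text \<open>Minimal shadows are strictly subadditive in the size of the set. Translate the sets such that the
lex greatest element of \<open>A\<close> and the lex smallest element of \<open>B\<close> become \<open>\<alpha> + \<beta>\<close> plus one unit, where
the unit for \<open>A\<close> is in the second coordinate and the one for \<open>B\<close> in the first. Then the translate of
\<open>A\<close> precedes that of \<open>B\<close>, but the shadows share \<open>\<alpha> + \<beta>\<close> plus both units.\<close>

lemma merge:
  assumes A: "A \<subseteq> comps n r" "A \<noteq> {}" and B: "B \<subseteq> comps n s" "B \<noteq> {}" and n: "2 \<le> n"
  shows "\<exists>C \<subseteq> comps n (Suc (r + s)). card C = card A + card B \<and> card (up C) < card (up A) + card (up B)"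
proof -
  obtain \<alpha> where \<alpha>: "\<alpha> \<in> A" "\<And>u. u \<in> A \<Longrightarrow> u = \<alpha> \<or> lex_less u \<alpha>" using lex_greatest[OF A] by blast
  obtain \<beta> where \<beta>: "\<beta> \<in> B" "\<And>u. u \<in> B \<Longrightarrow> u = \<beta> \<or> lex_less \<beta> u" using lex_smallest[OF B] by blast
  have \<alpha>c: "length \<alpha> = n" "sum_list \<alpha> = r" and \<beta>c: "length \<beta> = n" "sum_list \<beta> = s"
    using \<alpha> A \<beta> B by (auto simp: comps_def)
  obtain a x where a: "\<alpha> = a # x" using \<alpha>c n by (cases \<alpha>) auto
  obtain b c y where b: "\<beta> = b # c # y" using \<beta>c n by (cases \<beta> rule: remdups_adj.cases) auto
  define \<alpha>' where "\<alpha>' = Suc a # x"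
  define \<beta>' where "\<beta>' = b # Suc c # y"
  have cov: "covers \<alpha> \<alpha>'" "covers \<beta> \<beta>'" by (simp_all add: \<alpha>'_def \<beta>'_def a b covers_Cons)
  have len: "length \<alpha>' = n" "length \<beta>' = n" and sums: "sum_list \<alpha>' = Suc r" "sum_list \<beta>' = Suc s"
    using cov \<alpha>c \<beta>c covers_length covers_sum_list by auto
  define A' where "A' = translate \<beta>' A"
  define B' where "B' = translate \<alpha>' B"
  have A'c: "A' \<subseteq> comps n (Suc (r + s))"
    using translate_comps[OF A(1) len(2)] sums by (simp add: A'_def)
  have B'c: "B' \<subseteq> comps n (Suc (r + s))"
    using translate_comps[OF B(1) len(1)] sums by (simp add: B'_def add.commute)
  have fin: "finite A'" "finite B'" using A'c B'c finite_comps finite_subset by blast+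
  have mid: "lex_less (padd \<alpha> \<beta>') (padd \<beta> \<alpha>')"
    using \<alpha>c \<beta>c a b by (simp add: \<alpha>'_def \<beta>'_def)
  have "A' \<inter> B' = {}"
  proof (rule ccontr)
    assume "A' \<inter> B' \<noteq> {}"
    then obtain u v where uv: "u \<in> A" "v \<in> B" "padd u \<beta>' = padd v \<alpha>'"
      by (auto simp: A'_def B'_def translate_def)
    then have "length u = n" "length v = n" using A B by (auto simp: comps_def)
    then have "padd u \<beta>' = padd \<alpha> \<beta>' \<or> lex_less (padd u \<beta>') (padd \<alpha> \<beta>')"
      "padd v \<alpha>' = padd \<beta> \<alpha>' \<or> lex_less (padd \<beta> \<alpha>') (padd v \<alpha>')"
      using \<alpha>(2)[OF uv(1)] \<beta>(2)[OF uv(2)] len \<alpha>c \<beta>c by (auto simp: lex_less_padd)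
    then show False using mid uv(3) lex_less_trans lex_less_irrefl by metis
  qed
  moreover have "card A' = card A" "card B' = card B"
    unfolding A'_def B'_def using card_translate A(1) B(1) len by blast+
  ultimately have cardC: "card (A' \<union> B') = card A + card B" using fin by (simp add: card_Un_disjoint)
  have up: "card (up A') = card (up A)" "card (up B') = card (up B)"
    unfolding A'_def B'_def
    using up_translate[OF A(1) len(2)] up_translate[OF B(1) len(1)]
      card_translate[OF up_comps[OF A(1)] len(2)] card_translate[OF up_comps[OF B(1)] len(1)] by auto
  have "padd \<alpha>' \<beta>' \<in> up A'" "padd \<beta>' \<alpha>' \<in> up B'"
    using cov \<alpha>(1) \<beta>(1)
    unfolding A'_def B'_def up_translate[OF A(1) len(2)] up_translate[OF B(1) len(1)]
    by (auto simp: translate_def up_def)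
  then have "up A' \<inter> up B' \<noteq> {}" using padd_commute[of \<alpha>' \<beta>'] by auto
  then have "card (up A' \<inter> up B') > 0" using fin finite_up by (simp add: card_gt_0_iff)
  then have "card (up (A' \<union> B')) < card (up A) + card (up B)"
    using card_Un_Int[of "up A'" "up B'"] fin finite_up up by (simp add: up_Un)
  then show ?thesis using A'c B'c cardC by (intro exI[of _ "A' \<union> B'"]) simp
qed

lemma up_comps_all: "0 < n \<Longrightarrow> up (comps n k) = comps n (Suc k)"
proof (intro equalityI subsetI)
  fix v assume v: "v \<in> comps n (Suc k)"
  then obtain u where u: "covers u v" using ex_covered[of v] by (auto simp: comps_def)
  then have "u \<in> comps n k" using v covers_length[OF u] covers_sum_list[OF u] by (simp add: comps_def)
  then show "v \<in> up (comps n k)" using u by (auto simp: up_def)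
qed (use up_comps in blast)

section \<open>From the corners of the grid to the unbounded grid\<close>

lemma shadow_eq_up:
  assumes "S \<subseteq> level n d r" shows "shadow n d S = up S \<inter> grid n d"
proof -
  have "length u = n" if "u \<in> S" for u using assms that by (auto simp: level_def grid_def)
  then show ?thesis unfolding shadow_def elem_shadow_def up_def covers_def by auto
qed

lemma shadow_level:
  assumes "S \<subseteq> level n d r" shows "shadow n d S \<subseteq> level n d (Suc r)"
proof -
  have "S \<subseteq> comps n r" using assms by (auto simp: level_def grid_def rank_def comps_def)
  then have "up S \<subseteq> comps n (Suc r)" by (rule up_comps)
  then show ?thesis unfolding shadow_eq_up[OF assms] by (auto simp: level_def rank_def comps_def)
qed

lemma level_iff: "u \<in> level n d r \<longleftrightarrow> u \<in> comps n r \<and> (\<forall>i<n. u ! i < d)"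
  by (auto simp: level_def grid_def rank_def comps_def in_set_conv_nth subset_iff)

lemma two_entries_le_sum_list:
  fixes u :: "nat list"
  assumes "i < length u" "j < length u" "i \<noteq> j" shows "u ! i + u ! j \<le> sum_list u"
proof -
  have "u ! i + u ! j = (\<Sum>l\<in>{i, j}. u ! l)" using assms by simp
  also have "\<dots> \<le> (\<Sum>l\<in>{0..<length u}. u ! l)" using assms by (intro sum_mono2) auto
  finally show ?thesis by (simp add: sum_list_sum_nth)
qed

definition lower :: "nat \<Rightarrow> nat \<Rightarrow> nat list \<Rightarrow> nat list" where
  "lower c d w = w[c := w ! c - d]"

lemma length_lower [simp]: "length (lower c d w) = length w" by (simp add: lower_def)

lemma sum_list_lower:
  assumes "c < length w" "d \<le> w ! c" shows "sum_list (lower c d w) + d = sum_list w"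
  using assms sum_list_update[of c w "w ! c - d"] elem_le_sum_list[of c w]
  by (simp add: lower_def)

lemma covers_lower:
  assumes "c < length w" "d \<le> w ! c"
  shows "covers (lower c d w) x \<longleftrightarrow> (\<exists>w'. covers w w' \<and> x = lower c d w')"
proof -
  have "(lower c d w)[i := Suc (lower c d w ! i)] = lower c d (w[i := Suc (w ! i)])"
    if "i < length w" for i
    using assms that
    by (cases "i = c") (simp_all add: lower_def Suc_diff_le list_update_swap)
  then show ?thesis unfolding covers_def by auto
qed

lemma covers_nth:
  assumes "covers u v" "i < length u" shows "u ! i \<le> v ! i" "v ! i \<le> Suc (u ! i)"
  using assms by (auto simp: covers_def nth_list_update)

text \<open>The threshold \<open>t\<close> tells which entries count as large. The point \<open>p\<close> serves as origin: all tuples are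
translated by it so that the coordinates that become negative remain natural numbers. Its rank is
\<open>d\<close>, so subtracting \<open>d\<close> from one entry and adding \<open>p\<close> preserves ranks.\<close>

locale corners =
  fixes n d t :: nat and p :: "nat list"
  assumes n: "0 < n" and length_p: "length p = n" and sum_p: "sum_list p = d"
begin

text \<open>The simplex of all tuples above \<open>p\<close>, and around it the elements of \<open>S\<close>, moved from the corner of
coordinate \<open>c\<close> to the side of the simplex beyond which coordinate \<open>c\<close> is less than that of \<open>p\<close>.\<close>

definition assemble :: "nat \<Rightarrow> nat list set \<Rightarrow> nat list set" where
  "assemble k S = translate p (comps n k) \<union>
     {lower c d (padd u p) | u c. u \<in> S \<and> c < n \<and> t \<le> u ! c}"

text \<open>Every element has a large entry, and subtracting \<open>d\<close> from it makes sense after adding \<open>p\<close>. By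
\<open>d + k < 2 * t\<close> there is no room for two large entries; by \<open>Suc k < t\<close> the other entries are so
small that raising them never meets the bound of the grid.\<close>

definition cornered :: "nat \<Rightarrow> nat list set \<Rightarrow> bool" where
  "cornered k S \<longleftrightarrow> S \<subseteq> level n d (d + k) \<and> d + k < 2 * t \<and> Suc k < t \<and>
     (\<forall>u\<in>S. (\<exists>c<n. t \<le> u ! c) \<and> (\<forall>c<n. t \<le> u ! c \<longrightarrow> d \<le> u ! c + p ! c))"

lemma corner_unique:
  assumes "cornered k S" "u \<in> S" "c < n" "c' < n" "t \<le> u ! c" "t \<le> u ! c'" shows "c = c'"
proof (rule ccontr)
  assume "c \<noteq> c'"
  have "length u = n" "sum_list u = d + k" "d + k < 2 * t"
    using assms by (auto simp: cornered_def level_iff comps_def)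
  then show False using two_entries_le_sum_list[of c u c'] assms \<open>c \<noteq> c'\<close> by simp
qed

lemma nth_assembled:
  assumes "cornered k S" "u \<in> S" "c < n" "t \<le> u ! c" "i < n"
  shows "lower c d (padd u p) ! i < p ! i \<longleftrightarrow> i = c"
proof -
  have "length u = n" "u ! c < d" "d \<le> u ! c + p ! c" using assms by (auto simp: cornered_def level_iff comps_def)
  then show ?thesis using assms length_p by (auto simp: lower_def nth_list_update nth_padd)
qed

lemma assemble_comps:
  assumes S: "cornered k S" shows "assemble k S \<subseteq> comps n (d + k)"
proof -
  have "lower c d (padd u p) \<in> comps n (d + k)" if u: "u \<in> S" "c < n" "t \<le> u ! c" for u c
  proof -
    have "length u = n" "sum_list u = d + k" "d \<le> u ! c + p ! c"
      using S u by (auto simp: cornered_def level_iff comps_def)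
    then show ?thesis using sum_list_lower[of c "padd u p" d] u length_p sum_p
      by (simp add: comps_def nth_padd sum_list_padd)
  qed
  then show ?thesis using translate_comps[OF order_refl length_p, of k] sum_p
    by (auto simp: assemble_def add.commute)
qed

text \<open>The pieces are disjoint, since the coordinate below \<open>p\<close>, if there is one, reveals the corner.\<close>

lemma card_assemble:
  assumes S: "cornered k S" shows "card (assemble k S) = card (comps n k) + card S"
proof -
  let ?T = "{lower c d (padd u p) | u c. u \<in> S \<and> c < n \<and> t \<le> u ! c}"
  have len: "length u = n" if "u \<in> S" for u using S that by (auto simp: cornered_def level_iff comps_def)
  obtain \<chi> where \<chi>: "\<And>u. u \<in> S \<Longrightarrow> \<chi> u < n \<and> t \<le> u ! \<chi> u"
    using S unfolding cornered_def by metis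
  have T: "?T = (\<lambda>u. lower (\<chi> u) d (padd u p)) ` S"
    using \<chi> corner_unique[OF S] by blast
  have "inj_on (\<lambda>u. lower (\<chi> u) d (padd u p)) S"
  proof (rule inj_onI)
    fix u v assume u: "u \<in> S" and v: "v \<in> S" and eq: "lower (\<chi> u) d (padd u p) = lower (\<chi> v) d (padd v p)"
    have c: "\<chi> u = \<chi> v"
      using nth_assembled[OF S u, of "\<chi> u" "\<chi> u"] nth_assembled[OF S v, of "\<chi> v" "\<chi> u"] \<chi>[OF u] \<chi>[OF v] eq
      by simp
    have "padd u p ! i = padd v p ! i" if "i < n" for i
    proof -
      have "lower (\<chi> u) d (padd u p) ! i = lower (\<chi> u) d (padd v p) ! i" using eq c by simp
      moreover have "d \<le> padd u p ! \<chi> u" "d \<le> padd v p ! \<chi> u"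
        using S u v \<chi>[OF u] \<chi>[OF v] c len length_p by (auto simp: cornered_def nth_padd)
      ultimately show ?thesis using that len[OF u] len[OF v] length_p
        by (cases "i = \<chi> u") (auto simp: lower_def nth_list_update)
    qed
    then have "padd u p = padd v p" using len u v length_p by (intro nth_equalityI) auto
    then show "u = v" using len u v length_p padd_inject by metis
  qed
  then have "card ?T = card S" unfolding T by (rule card_image)
  moreover have "translate p (comps n k) \<inter> ?T = {}"
  proof -
    have "\<not> padd x p ! c < p ! c" if "x \<in> comps n k" "c < n" for x c
      using that length_p by (simp add: comps_def nth_padd)
    then show ?thesis using nth_assembled[OF S] by (fastforce simp: translate_def)
  qed
  moreover have "finite S" using S finite_subset[OF _ finite_level] unfolding cornered_def by blast
  then have "finite ?T" unfolding T by simp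
  moreover have "finite (translate p (comps n k))" by (simp add: translate_def finite_comps)
  ultimately show ?thesis
    using card_translate[OF order_refl length_p] by (simp add: assemble_def card_Un_disjoint)
qed

lemma cornered_shadow:
  assumes S: "cornered k S" and small: "d + Suc k < 2 * t" "Suc (Suc k) < t"
  shows "cornered (Suc k) (shadow n d S)"
proof -
  have lev: "S \<subseteq> level n d (d + k)" using S by (simp add: cornered_def)
  have "(\<exists>c<n. t \<le> v ! c) \<and> (\<forall>c<n. t \<le> v ! c \<longrightarrow> d \<le> v ! c + p ! c)" if v: "v \<in> shadow n d S" for v
  proof -
    obtain u where u: "u \<in> S" "covers u v" using v by (auto simp: shadow_eq_up[OF lev] up_def)
    have len: "length u = n" "length v = n" using u lev covers_length[OF u(2)] by (auto simp: level_iff comps_def)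
    obtain c where c: "c < n" "t \<le> u ! c" "d \<le> u ! c + p ! c" using S u by (auto simp: cornered_def)
    then have c': "t \<le> v ! c" "d \<le> v ! c + p ! c" using covers_nth(1)[OF u(2)] len by (fastforce)+
    have "sum_list v = d + Suc k" using v shadow_level[OF lev] by (auto simp: level_iff comps_def)
    then have "i = c" if "i < n" "t \<le> v ! i" for i
      using two_entries_le_sum_list[of i v c] that c c' len small by (cases "i = c") auto
    then show ?thesis using c(1) c' by blast
  qed
  then show ?thesis using shadow_level[OF lev] small by (simp add: cornered_def)
qed

text \<open>Raising the large entry of a tuple from \<open>d - 1\<close> to \<open>d\<close> leaves the grid, but after the subtraction of
\<open>d\<close> it leads into the simplex, all of which is in the shadow anyway. All other raises correspond.\<close>

lemma up_assemble:
  assumes S: "cornered k S" and small: "d + Suc k < 2 * t" "Suc (Suc k) < t"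
  shows "up (assemble k S) = assemble (Suc k) (shadow n d S)"
proof -
  have lev: "S \<subseteq> level n d (d + k)" using S by (simp add: cornered_def)
  let ?T = "{lower c d (padd u p) | u c. u \<in> S \<and> c < n \<and> t \<le> u ! c}"
  let ?T' = "{lower c d (padd u p) | u c. u \<in> shadow n d S \<and> c < n \<and> t \<le> u ! c}"
  have base: "up (translate p (comps n k)) = translate p (comps n (Suc k))"
    using up_translate[OF order_refl length_p] up_comps_all[OF n] by simp
  have cov: "covers (lower c d (padd u p)) x \<longleftrightarrow> (\<exists>v. covers u v \<and> x = lower c d (padd v p))"
    if "u \<in> S" "c < n" "t \<le> u ! c" for u c x
  proof -
    have "length u = n" "d \<le> u ! c + p ! c" using S that by (auto simp: cornered_def level_iff comps_def)
    then show ?thesis using covers_lower[of c "padd u p" d x] covers_padd[of u p] that length_p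
      by (auto simp: nth_padd)
  qed
  have "up ?T \<subseteq> ?T' \<union> translate p (comps n (Suc k))"
  proof
    fix x assume "x \<in> up ?T"
    then obtain u c where u: "u \<in> S" "c < n" "t \<le> u ! c" "covers (lower c d (padd u p)) x"
      by (auto simp: up_def)
    then obtain v where v: "covers u v" "x = lower c d (padd v p)" using cov by blast
    have len: "length u = n" "length v = n" and sum: "sum_list u = d + k" and bound: "\<And>i. i < n \<Longrightarrow> u ! i < d"
      using u lev covers_length[OF v(1)] by (auto simp: level_iff comps_def)
    have tv: "t \<le> v ! c" using covers_nth(1)[OF v(1), of c] u len by simp
    show "x \<in> ?T' \<union> translate p (comps n (Suc k))"
    proof (cases "v ! c < d")
      case True
      have "v ! i < d" if "i < n" for i
        using two_entries_le_sum_list[of i u c] covers_nth(2)[OF v(1), of i] that u len sum small True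
        by (cases "i = c") auto
      then have "v \<in> shadow n d S"
        unfolding shadow_eq_up[OF lev] using u v len
        by (auto simp: up_def grid_def in_set_conv_nth)
      then show ?thesis using v u tv by blast
    next
      case False
      then have vc: "v ! c = d" using covers_nth(2)[OF v(1), of c] bound[OF u(2)] u len by simp
      have "x = padd (lower c d v) p"
        using v len length_p vc u by (auto simp: lower_def nth_list_update nth_padd intro!: nth_equalityI)
      moreover have "lower c d v \<in> comps n (Suc k)"
        using sum_list_lower[of c v d] vc len u covers_sum_list[OF v(1)] sum by (simp add: comps_def)
      ultimately show ?thesis by (auto simp: translate_def)
    qed
  qed
  moreover have "?T' \<subseteq> up ?T"
  proof
    fix x assume "x \<in> ?T'"
    then obtain v c where v: "v \<in> shadow n d S" "c < n" "t \<le> v ! c" "x = lower c d (padd v p)" by blast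
    then obtain u where u: "u \<in> S" "covers u v" by (auto simp: shadow_eq_up[OF lev] up_def)
    obtain c' where c': "c' < n" "t \<le> u ! c'" using S u by (auto simp: cornered_def)
    have len: "length u = n" using u lev by (auto simp: level_iff comps_def)
    have "t \<le> v ! c'" using covers_nth(1)[OF u(2), of c'] c' len by simp
    then have "c' = c" using corner_unique[OF cornered_shadow[OF S small] v(1)] c' v by blast
    then have "covers (lower c d (padd u p)) x" using cov u v c' by blast
    then show "x \<in> up ?T" using u c' \<open>c' = c\<close> unfolding up_def by blast
  qed
  ultimately show ?thesis by (auto simp: assemble_def up_Un base)
qed

end

section \<open>Lex segments in large grids and persistence\<close>

lemma upward_closed_in_level_unique:
  assumes A: "A \<subseteq> level n d r" "\<And>u v. u \<in> A \<Longrightarrow> v \<in> level n d r \<Longrightarrow> lex_less u v \<Longrightarrow> v \<in> A"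
  shows "lex_segment n d r (card A) = A"
proof -
  let ?B = "lex_segment n d r (card A)"
  have "?B \<subseteq> level n d r" by (auto simp: lex_segment_def)
  then have fin: "finite A" "finite ?B" using A(1) finite_subset[OF _ finite_level] by blast+
  have card: "card ?B = card A" using A by (intro card_lex_segment card_mono finite_level)
  have "A \<subseteq> ?B \<or> ?B \<subseteq> A"
  proof (rule ccontr)
    assume "\<not> ?thesis"
    then obtain a b where ab: "a \<in> A" "a \<notin> ?B" "b \<in> ?B" "b \<notin> A" by blast
    then have lev: "a \<in> level n d r" "b \<in> level n d r" "a \<noteq> b" using A by (auto simp: lex_segment_def)
    then have "lex_less a b \<or> lex_less b a"
      by (intro lex_less_total) (auto simp: level_iff comps_def)
    then show False using ab lev A(2) lex_segment_upward_closed by blast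
  qed
  then show ?thesis using card fin card_subset_eq by metis
qed

text \<open>Already the \<open>s\<close> tuples \<open>(d - 1 - j, k + 1 + j, 0, \<dots>, 0)\<close> with \<open>j < s\<close> have first entry at least
\<open>d - s\<close>, so no element of a segment of size \<open>s\<close> can have a smaller one.\<close>

lemma lex_segment_hd_large:
  assumes n: "2 \<le> n" and d: "k + s < d" and u: "u \<in> lex_segment n d (d + k) s"
  shows "d - s \<le> u ! 0"
proof (rule ccontr)
  assume less: "\<not> d - s \<le> u ! 0"
  define g where "g j = (d - Suc j) # (k + Suc j) # replicate (n - 2) 0" for j
  have len: "length u = n" using u by (auto simp: lex_segment_def level_iff comps_def)
  have "g ` {..<s} \<subseteq> {v \<in> level n d (d + k). lex_less u v}"
  proof clarify
    fix j assume j: "j < s"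
    have "g j \<in> level n d (d + k)"
      using n d j by (auto simp: g_def level_iff comps_def sum_list_replicate nth_Cons split: nat.split)
    moreover have "lex_less u (g j)"
      using less len n d j by (cases u) (auto simp: g_def)
    ultimately show "g j \<in> level n d (d + k) \<and> lex_less u (g j)" by blast
  qed
  moreover have "inj_on g {..<s}" by (auto simp: g_def inj_on_def)
  then have "card (g ` {..<s}) = s" by (simp add: card_image)
  ultimately have "s \<le> card {v \<in> level n d (d + k). lex_less u v}"
    using card_mono[of "{v \<in> level n d (d + k). lex_less u v}" "g ` {..<s}"] finite_level by simp
  then show False using u by (simp add: lex_segment_def)
qed

context corners
begin

text \<open>With the origin \<open>(d, 0, \<dots>, 0)\<close> and all large entries in front, nothing moves: the set is just
completed by the tuples whose first entry exceeds the bound of the grid. These are the lex largest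
ones, which is why segments of the grid correspond to segments of $\mathbb{N}^n$.\<close>

lemma assemble_hd:
  assumes p: "p = d # replicate m 0" and S: "cornered k S" and hd: "\<forall>u\<in>S. t \<le> u ! 0"
  shows "assemble k S = {w \<in> comps n (d + k). d \<le> w ! 0} \<union> S"
proof -
  have nm: "n = Suc m" using length_p p by simp
  have zero: "padd x (replicate m 0) = x" if "length x = m" for x
    using that by (induction x arbitrary: m) auto
  have "translate p (comps n k) = {w \<in> comps n (d + k). d \<le> w ! 0}"
  proof (intro equalityI subsetI)
    fix w assume w: "w \<in> translate p (comps n k)"
    then have "w \<in> comps n (d + k)"
      using translate_comps[OF order_refl length_p, of k] sum_p by (auto simp: add.commute)
    moreover have "d \<le> w ! 0" using w p nm by (auto simp: translate_def comps_def nth_padd)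
    ultimately show "w \<in> {w \<in> comps n (d + k). d \<le> w ! 0}" by simp
  next
    fix w assume w: "w \<in> {w \<in> comps n (d + k). d \<le> w ! 0}"
    then obtain a x where ax: "w = a # x" "length x = m" using nm by (cases w) (auto simp: comps_def)
    then have "w = padd ((a - d) # x) p" "(a - d) # x \<in> comps n k"
      using w p zero nm by (auto simp: comps_def)
    then show "w \<in> translate p (comps n k)" unfolding translate_def by blast
  qed
  moreover have "lower 0 d (padd u p) = u" if "u \<in> S" for u
  proof -
    have "length u = n" using S that by (auto simp: cornered_def level_iff comps_def)
    then have "length u = Suc m" by (simp add: nm)
    then show ?thesis using p zero by (cases u) (auto simp: lower_def)
  qed
  then have "{lower c d (padd u p) | u c. u \<in> S \<and> c < n \<and> t \<le> u ! c} = S"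
    using hd corner_unique[OF S _ n] n by force
  ultimately show ?thesis by (simp add: assemble_def)
qed

lemma segment_assemble_hd:
  assumes p: "p = d # replicate m 0" and S: "cornered k S" and hd: "\<forall>u\<in>S. t \<le> u ! 0"
  shows "segment n (d + k) (assemble k S) \<longleftrightarrow>
    (\<forall>u\<in>S. \<forall>v\<in>level n d (d + k). lex_less u v \<longrightarrow> v \<in> S)"
proof
  have nm: "n = Suc m" using length_p p by simp
  have lev: "S \<subseteq> level n d (d + k)" using S by (simp add: cornered_def)
  {
    assume seg: "segment n (d + k) (assemble k S)"
    show "\<forall>u\<in>S. \<forall>v\<in>level n d (d + k). lex_less u v \<longrightarrow> v \<in> S"
    proof (intro ballI impI)
      fix u v assume "u \<in> S" "v \<in> level n d (d + k)" "lex_less u v"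
      then have "v \<in> assemble k S" "v ! 0 < d"
        using seg n unfolding segment_def assemble_hd[OF assms] by (auto simp: level_iff)
      then show "v \<in> S" unfolding assemble_hd[OF assms] by simp
    qed
  next
    assume closed: "\<forall>u\<in>S. \<forall>v\<in>level n d (d + k). lex_less u v \<longrightarrow> v \<in> S"
    show "segment n (d + k) (assemble k S)"
      unfolding segment_def
    proof (intro conjI ballI impI)
      show "assemble k S \<subseteq> comps n (d + k)" by (rule assemble_comps[OF S])
      fix w v assume w: "w \<in> assemble k S" and v: "v \<in> comps n (d + k)" and less: "lex_less w v"
      show "v \<in> assemble k S"
      proof (cases "d \<le> v ! 0")
        case True
        then show ?thesis using v unfolding assemble_hd[OF assms] by simp
      next
        case False
        have len: "length w = n" "length v = n" using w assemble_comps[OF S] v by (auto simp: comps_def)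
        then have le: "w ! 0 \<le> v ! 0" using less n by (cases w; cases v) auto
        then have wS: "w \<in> S" using w False unfolding assemble_hd[OF assms] by auto
        have "v ! i < d" if "i < n" for i
          using two_entries_le_sum_list[of 0 v i] that False le bspec[OF hd wS] S v len n
          by (cases "i = 0") (auto simp: cornered_def comps_def)
        then have "v \<in> S" using closed wS less v by (auto simp: level_iff)
        then show ?thesis unfolding assemble_hd[OF assms] by simp
      qed
    qed
  }
qed

end

theorem theorem1p7:
  fixes n k \<delta> :: nat
  assumes "n \<ge> 3"
  shows "\<exists>D::nat. \<forall>d\<ge>D. \<forall>S. optimal n d (d + k) S \<and> card S = \<delta>
           \<longrightarrow> optimal n d (d + k + 1) (shadow n d S)"
proof (intro exI[of _ "(n + 2) * (2 * \<delta> + 2) + 2 * k + 10"] allI impI, elim conjE)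
  fix d S
  assume d: "(n + 2) * (2 * \<delta> + 2) + 2 * k + 10 \<le> d"
    and opt: "optimal n d (d + k) S" and card_S: "card S = \<delta>"
  have S: "S \<subseteq> level n d (d + k)" using opt by (simp add: optimal_def)
  have fin_S: "finite S" using finite_subset[OF S finite_level] .
  \<comment> \<open>Pigeonhole: \<open>\<delta> + 1\<close> candidates for the gap \<open>d - b\<close> and \<open>\<delta>\<close> elements. The lower bound on \<open>b\<close> puts
    the first entries of the lex segment, which are at least \<open>d - \<delta>\<close>, above the gap.\<close>
  obtain b where b: "\<delta> + 1 \<le> b" "b \<le> 2 * \<delta> + 1" and gap: "\<And>u. u \<in> S \<Longrightarrow> d - Max (set u) \<noteq> b"
  proof -
    have "\<not> {\<delta> + 1..2 * \<delta> + 1} \<subseteq> (\<lambda>u. d - Max (set u)) ` S"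
    proof
      assume "{\<delta> + 1..2 * \<delta> + 1} \<subseteq> (\<lambda>u. d - Max (set u)) ` S"
      then have "card {\<delta> + 1..2 * \<delta> + 1} \<le> card ((\<lambda>u. d - Max (set u)) ` S)"
        using fin_S by (intro card_mono) auto
      also have "\<dots> \<le> \<delta>" using card_image_le[OF fin_S] card_S by blast
      finally show False by simp
    qed
    then show ?thesis using that by fastforce
  qed
  \<comment> \<open>The only consequence of the size of \<open>d\<close> that is used below.\<close>
  have "(n + 2) * b \<le> (n + 2) * (2 * \<delta> + 2)" using b by (intro mult_le_mono2) simp
  then have large: "n * b + 2 * b + 2 * k + 10 \<le> d" using d by (simp add: algebra_simps)
  define t where "t = Suc (d - b)"
  have t: "d + Suc k < 2 * t" "Suc (Suc k) < t" using large by (auto simp: t_def)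
  obtain m where m: "n = Suc m" using assms by (cases n) auto
  define p where "p = d # replicate m 0"
  \<comment> \<open>Entries of \<open>S\<close> above the gap are at least \<open>d - b + 1\<close>, so an offset of \<open>b\<close> in each coordinate is
    enough; the first coordinate takes the remaining part of \<open>d\<close>.\<close>
  define q where "q = (d - m * b) # replicate m b"
  have mb: "m * b + b \<le> d" using large m by simp
  interpret F: corners n d t p
    using assms m by unfold_locales (auto simp: p_def sum_list_replicate)
  interpret G: corners n d t q
    using assms m mb by unfold_locales (auto simp: q_def sum_list_replicate)

  define L where "L = lex_segment n d (d + k) \<delta>"
  have L: "L \<subseteq> level n d (d + k)" by (auto simp: L_def lex_segment_def)
  have "\<delta> \<le> card (level n d (d + k))" using card_mono[OF finite_level S] card_S by simp
  then have card_L: "card L = \<delta>" unfolding L_def by (rule card_lex_segment)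
  have up_eq: "card (shadow n d S) = card (shadow n d L)"
    using opt card_S by (simp add: optimal_def L_def)
  have hd_L: "\<forall>u\<in>L. t \<le> u ! 0"
  proof
    fix u assume "u \<in> L"
    then show "t \<le> u ! 0"
      using lex_segment_hd_large[of n k \<delta> d u] assms b large by (simp add: L_def t_def)
  qed
  have corner_0: "c = 0" if "u \<in> L" "c < n" "t \<le> u ! c" for u c
  proof (rule ccontr)
    assume "c \<noteq> 0"
    moreover have "length u = n" "sum_list u = d + k" using that L by (auto simp: level_iff comps_def)
    ultimately show False using two_entries_le_sum_list[of 0 u c] bspec[OF hd_L that(1)] that t by simp
  qed
  have cor_L: "F.cornered k L"
    unfolding F.cornered_def
  proof (intro conjI ballI)
    fix u assume u: "u \<in> L"
    show "\<exists>c<n. t \<le> u ! c" using bspec[OF hd_L u] F.n by blast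
    show "\<forall>c<n. t \<le> u ! c \<longrightarrow> d \<le> u ! c + p ! c"
      using corner_0[OF u] by (metis le_add2 nth_Cons_0 p_def)
  qed (use L t in auto)
  define M where "M = F.assemble k L"
  have Mc: "M \<subseteq> comps n (d + k)" unfolding M_def by (rule F.assemble_comps[OF cor_L])
  \<comment> \<open>\<open>M\<close> is a segment without bound, the standard of comparison for \<open>W\<close>.\<close>
  have seg_M: "segment n (d + k) M"
    unfolding M_def F.segment_assemble_hd[OF p_def cor_L hd_L]
    using lex_segment_upward_closed by (auto simp: L_def)
  have cor_L': "F.cornered (Suc k) (shadow n d L)" by (rule F.cornered_shadow[OF cor_L t])
  have up_M: "up M = F.assemble (Suc k) (shadow n d L)" unfolding M_def by (rule F.up_assemble[OF cor_L t])
  have card_up_M: "card (up M) = card (comps n (Suc k)) + card (shadow n d L)"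
    unfolding up_M by (rule F.card_assemble[OF cor_L'])

  define X where "X = {u \<in> S. \<exists>c<n. t \<le> u ! c}"
  define Z where "Z = S - X"
  have cor_X: "G.cornered k X"
    unfolding G.cornered_def
  proof (intro conjI ballI)
    fix u assume u: "u \<in> X"
    have "b \<le> q ! c" if "c < n" for c
      using that m mb by (cases c) (auto simp: q_def)
    then show "\<forall>c<n. t \<le> u ! c \<longrightarrow> d \<le> u ! c + q ! c" by (fastforce simp: t_def)
  qed (use S t in \<open>auto simp: X_def\<close>)
  define W where "W = G.assemble k X"
  have Wc: "W \<subseteq> comps n (d + k)" unfolding W_def by (rule G.assemble_comps[OF cor_X])
  have cor_X': "G.cornered (Suc k) (shadow n d X)" by (rule G.cornered_shadow[OF cor_X t])
  have up_W: "up W = G.assemble (Suc k) (shadow n d X)" unfolding W_def by (rule G.up_assemble[OF cor_X t])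
  have card_W: "card W = card (comps n k) + card X" unfolding W_def by (rule G.card_assemble[OF cor_X])
  have card_up_W: "card (up W) = card (comps n (Suc k)) + card (shadow n d X)"
    unfolding up_W by (rule G.card_assemble[OF cor_X'])

  have P: "persistent n" using assms by (intro persistent_all) simp
  have "Z = {}"
  proof (rule ccontr)
    assume "Z \<noteq> {}"
    have Zc: "Z \<subseteq> comps n (d + k)" and Zl: "Z \<subseteq> level n d (d + k)"
      using S by (auto simp: Z_def level_iff)
    have Z_small: "u ! c < d - b" if u: "u \<in> Z" and c: "c < n" for u c
    proof -
      have "length u = n" using Zc u by (auto simp: comps_def)
      then have ne: "set u \<noteq> {}" using assms by auto
      have "\<forall>x\<in>set u. x \<le> d - b"
        using u \<open>length u = n\<close> by (fastforce simp: Z_def X_def t_def in_set_conv_nth)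
      then have "Max (set u) \<le> d - b" using ne by simp
      moreover have "d - Max (set u) \<noteq> b" using gap u by (simp add: Z_def)
      ultimately have "Max (set u) < d - b" using large by linarith
      then show ?thesis using ne c \<open>length u = n\<close> by (simp add: nth_mem)
    qed
    have small_up: "v ! c < t" if vc: "v \<in> up Z" "c < n" for v c
    proof -
      obtain u where u: "u \<in> Z" "covers u v" using vc by (auto simp: up_def)
      have "length u = n" using Zc u by (auto simp: comps_def)
      then show ?thesis using covers_nth(2)[OF u(2), of c] Z_small[OF u(1) vc(2)] vc by (simp add: t_def)
    qed
    have shadow_Z: "shadow n d Z = up Z"
    proof -
      have "up Z \<subseteq> grid n d"
      proof
        fix v assume v: "v \<in> up Z"
        then have "length v = n" using up_comps[OF Zc] by (auto simp: comps_def)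
        moreover have "v ! c < d" if "c < n" for c
          using small_up[OF v that] b large by (simp add: t_def)
        ultimately show "v \<in> grid n d" by (auto simp: grid_def in_set_conv_nth)
      qed
      then show ?thesis using shadow_eq_up[OF Zl] by blast
    qed
    have SXZ: "shadow n d S = shadow n d X \<union> shadow n d Z" by (auto simp: shadow_def X_def Z_def)
    have "shadow n d X \<inter> shadow n d Z = {}"
      using cor_X' small_up unfolding G.cornered_def shadow_Z by (meson disjoint_iff leD)
    moreover have "finite (shadow n d X)" "finite (shadow n d Z)"
      using finite_subset[OF shadow_level[OF S] finite_level] SXZ by auto
    ultimately have "card (shadow n d S) = card (shadow n d X) + card (up Z)"
      using SXZ shadow_Z by (simp add: card_Un_disjoint)
    then have ups: "card (up W) + card (up Z) = card (up M)"
      using up_eq card_up_M card_up_W by simp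
    have "card X + card Z = \<delta>"
      using card_S fin_S card_Un_disjoint[of X Z] by (auto simp: Z_def X_def Un_absorb1)
    then have cards: "card W + card Z = card M"
      using card_W F.card_assemble[OF cor_L] card_L by (simp add: M_def)
    have "k # replicate m 0 \<in> comps n k" using m by (simp add: comps_def sum_list_replicate)
    then have "card (comps n k) > 0" using finite_comps card_gt_0_iff by blast
    then have "W \<noteq> {}" using card_W by auto
    then obtain C where C: "C \<subseteq> comps n (Suc (d + k + (d + k)))" "card C = card W + card Z"
      "card (up C) < card (up W) + card (up Z)"
      using merge[OF Wc _ Zc \<open>Z \<noteq> {}\<close>] assms by auto
    \<comment> \<open>The merged set has a higher rank than \<open>M\<close>; translating \<open>M\<close> there makes them comparable.\<close>
    let ?e = "Suc (d + k) # replicate m 0"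
    let ?M = "translate ?e M"
    have "segment n (d + k + Suc (d + k)) ?M"
      using segment_translate_hd seg_M unfolding m by blast
    then have seg': "segment n (Suc (d + k + (d + k))) ?M" by simp
    have "card ?M = card C" using card_translate[OF Mc, of ?e] m C cards by simp
    then have "card (up ?M) \<le> card (up C)" by (intro persistentD(1)[OF P C(1) seg'])
    moreover have "card (up ?M) = card (up M)"
      using up_translate[OF Mc, of ?e] card_translate[OF up_comps[OF Mc], of ?e] m by simp
    ultimately show False using C ups by simp
  qed
  then have XS: "X = S" by (auto simp: Z_def X_def)
  have card_WM: "card M = card W" using card_W F.card_assemble[OF cor_L] card_L card_S XS by (simp add: M_def)
  have up_WM: "card (up W) = card (up M)" using card_up_M card_up_W up_eq XS by simp
  have "colour_bound W (card (up (up M)))"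
    by (rule persistentD(2)[OF P Wc seg_M card_WM up_WM])
  then have "card (up (up W)) \<le> card (up (up M))" by (rule colour_bound_up_up)
  moreover have "card (up (up M)) \<le> card (up (up W))"
    by (rule persistentD(1)[OF P up_comps[OF Wc] segment_up[OF seg_M] up_WM[symmetric]])
  moreover have t': "d + Suc (Suc k) < 2 * t" "Suc (Suc (Suc k)) < t" using large by (auto simp: t_def)
  have "card (up (up M)) = card (comps n (Suc (Suc k))) + card (shadow n d (shadow n d L))"
    unfolding up_M F.up_assemble[OF cor_L' t'] by (rule F.card_assemble[OF F.cornered_shadow[OF cor_L' t']])
  moreover have "card (up (up W)) = card (comps n (Suc (Suc k))) + card (shadow n d (shadow n d S))"
    unfolding up_W G.up_assemble[OF cor_X' t'] XS[symmetric]
    by (rule G.card_assemble[OF G.cornered_shadow[OF cor_X' t']])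
  ultimately have final: "card (shadow n d (shadow n d S)) = card (shadow n d (shadow n d L))" by simp

  have L': "shadow n d L \<subseteq> level n d (d + Suc k)" using shadow_level[OF L] by simp
  have hd_L': "\<forall>v\<in>shadow n d L. t \<le> v ! 0"
  proof
    fix v assume "v \<in> shadow n d L"
    then obtain u where u: "u \<in> L" "covers u v" by (auto simp: shadow_eq_up[OF L] up_def)
    then have "length u = n" using L by (auto simp: level_iff comps_def)
    then show "t \<le> v ! 0" using covers_nth(1)[OF u(2), of 0] bspec[OF hd_L u(1)] F.n by simp
  qed
  have "segment n (d + Suc k) (up M)" using segment_up[OF seg_M] by simp
  then have "lex_segment n d (d + Suc k) (card (shadow n d L)) = shadow n d L"
    unfolding up_M F.segment_assemble_hd[OF p_def cor_L' hd_L']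
    by (intro upward_closed_in_level_unique[OF L']) blast
  then show "optimal n d (d + k + 1) (shadow n d S)"
    using shadow_level[OF S] final up_eq by (simp add: optimal_def)
qed

end
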